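(* Let $q\ge 1$, let $U$ be a compact subset of $V$, and for $T>0$ let $\mathcal U_{ad}=\{f\in L^q(0,T;V): f(s)\in U \text{ for a.e. } s\in[0,T]\}$. Assume: (a) for each $N\ge1$ the linear flow $e^{L_N t}:\mathcal H_N\to\mathcal H_N$ extends to a $C_0$-semigroup $T_N(t)$ on $\mathcal H$, and $\|T_N(t)\|\le M e^{\omega t}$ for all $N\ge 1$, $t\ge0$; (b) $\lim_{N\to\infty}\|L_N\phi-L\phi\|_{\mathcal H}=0$ for all $\phi\in D(L)$; (c) $F:\mathcal H\to\mathcal H$ is locally Lipschitz; (d) for each $T>0$ and $(x,u)\in\mathcal H\times\mathcal U_{ad}$, the state equation admits a unique mild solution $y(\cdot;x,u)\in C([0,T],\mathcal H)$ and, for each $N\ge1$, its Galerkin approximation admits a unique solution $y_N(\cdot;\Pi_N x,u)\in C([0,T],\mathcal H)$; moreover there is a constant $\mathcal C=\mathcal C(T,x)$ such that $\|y(t;x,u)\|_{\mathcal H}\le\mathcal C$ and $\|y_N(t;\Pi_Nx,u)\|_{\mathcal H}\le\mathcal C$ for all $t\in[0,T]$, $N\ge1$, $u\in\mathcal U_{ad}$; (e) for each $T>0$ and $x\in\mathcal H$, $\lim_{N\to\infty}\sup_{u\in\mathcal U_{ad}}\sup_{t\in[0,T]}\|(\mathrm{Id}_{\mathcal H}-\Pi_N)y(t;x,u)\|_{\mathcal H}=0$; (f) $\mathfrak C:V\to\mathcal H$ is continuous. Then for every $T>0$ and every $x\in\mathcal H$, $$\lim_{N\to\infty}\ \sup_{u\in\mathcal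 U_{ad}}\ \sup_{t\in[0,T]}\|y_N(t;\Pi_N x,u)-y(t;x,u)\|_{\mathcal H}=0.$$
   Context: $\mathcal H$ and $V$ are separable Hilbert spaces; $F:\mathcal H\to\mathcal H$ and $\mathfrak C:V\to\mathcal H$ are (possibly nonlinear) maps, with $\mathfrak C(0)=0$. The operator $L:D(L)\subset\mathcal H\to\mathcal H$ is the infinitesimal generator of a $C_0$-semigroup $(T(t))_{t\ge0}$ of bounded linear operators on $\mathcal H$, and $M\ge1$, $\omega\ge0$ are constants with $\|T(t)\|\le Me^{\omega t}$ for $t\ge0$ ($\|\cdot\|$ is the operator norm). (The letter $T$ alone denotes the final time.) State equation: $\frac{dy}{dt}=Ly+F(y)+\mathfrak C(u(t))$ on $(0,T]$, $y(0)=x\in\mathcal H$. A mild solution over $[0,T]$ is $y\in C([0,T],\mathcal H)$ with $y(t)=T(t)x+\int_0^tT(t-s)F(y(s))\,ds+\int_0^tT(t-s)\mathfrak C(u(s))\,ds$ for $t\in[0,T]$; it is denoted $y(\cdot;x,u)$. Galerkin approximation: $(\mathcal H_N)_{N\ge1}$ is a sequence of finite-dimensional subspaces of $\mathcal H$ with $\mathcal H_N\subset D(L)$, $\Pi_N:\mathcal H\to\mathcal H_N$ is the orthogonal projector, and $\|(\Pi_N-\mathrm{Id})x\|_{\mathcal H}\to0$ as $N\to\infty$ for all $x\in\mathcal H$. Put $L_N:=\Pi_NL\Pi_N:\mathcal H\to\mathcal H_N$. The Galerkin approximation is $\frac{dy_N}{dt}=L_Ny_N+\Pi_NF(y_N)+\Pi_N\mathfrak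 C(u(t))$ on $[0,T]$, $y_N(0)=\Pi_Nx$, understood through the variation-of-constants formula $y_N(t)=e^{L_Nt}\Pi_Nx+\int_0^te^{L_N(t-s)}\Pi_NF(y_N(s))\,ds+\int_0^te^{L_N(t-s)}\Pi_N\mathfrak C(u(s))\,ds$; its solution is denoted $y_N(\cdot;\Pi_Nx,u)$. A map $f:\mathcal W_1\to\mathcal W_2$ between Banach spaces is locally Lipschitz if it is Lipschitz on every ball of $\mathcal W_1$ centered at the origin. *)

theory Defs
  imports "HOL-Analysis.Analysis"
begin

definition c0_semigroup :: "(real \<Rightarrow> ('h::real_normed_vector \<Rightarrow>\<^sub>L 'h)) \<Rightarrow> bool" where
  "c0_semigroup S \<longleftrightarrow>
     S 0 = id_blinfun \<and>
     (\<forall>s\<ge>0. \<forall>t\<ge>0. S (s + t) = S s o\<^sub>L S t) \<and>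
     (\<forall>x. ((\<lambda>t. blinfun_apply (S t) x) \<longlongrightarrow> x) (at_right 0))"

(* An unbounded operator is a pair of its domain D and a total function L;
   the values of L outside D are arbitrary. *)
definition infinitesimal_generator ::
  "(real \<Rightarrow> ('h::real_normed_vector \<Rightarrow>\<^sub>L 'h)) \<Rightarrow> 'h set \<Rightarrow> ('h \<Rightarrow> 'h) \<Rightarrow> bool" where
  "infinitesimal_generator S D L \<longleftrightarrow>
     D = {x. \<exists>z. ((\<lambda>h. (blinfun_apply (S h) x - x) /\<^sub>R h) \<longlongrightarrow> z) (at_right 0)} \<and>
     (\<forall>x\<in>D. ((\<lambda>h. (blinfun_apply (S h) x - x) /\<^sub>R h) \<longlongrightarrow> L x) (at_right 0))"

definition finite_dim_subspace :: "'h::real_vector set \<Rightarrow> bool" where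
  "finite_dim_subspace S \<longleftrightarrow> (\<exists>B. finite B \<and> S = span B)"

definition orthogonal_projector :: "'h::real_inner set \<Rightarrow> ('h \<Rightarrow> 'h) \<Rightarrow> bool" where
  "orthogonal_projector S P \<longleftrightarrow> (\<forall>x. P x \<in> S \<and> (\<forall>w\<in>S. (x - P x) \<bullet> w = 0))"

definition galerkin_operator :: "('h \<Rightarrow> 'h) \<Rightarrow> ('h \<Rightarrow> 'h) \<Rightarrow> 'h \<Rightarrow> 'h" where
  "galerkin_operator P L x = P (L (P x))"

(* The flow exp(tA) as an exponential series, meant for a linear A that maps a
   finite-dimensional subspace to itself, and for x in that subspace. The library's exp
   does not apply: the bounded operators are not an instance of real_normed_algebra_1. *)
definition exp_flow :: "('h::real_normed_vector \<Rightarrow> 'h) \<Rightarrow> real \<Rightarrow> 'h \<Rightarrow> 'h" where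
  "exp_flow A t x = (\<Sum>n. (t ^ n / fact n) *\<^sub>R (A ^^ n) x)"

definition lipschitz_on_balls :: "('a::real_normed_vector \<Rightarrow> 'b::real_normed_vector) \<Rightarrow> bool" where
  "lipschitz_on_balls f \<longleftrightarrow> (\<forall>r. \<exists>K. K-lipschitz_on (ball 0 r) f)"

(* y(t) = S(t) x + int_0^t S(t-s) G(y(s)) ds + int_0^t S(t-s) g(s) ds on [0,T], with Bochner
   integrals. Integrability is demanded explicitly because the Bochner integral of a
   non-integrable function is 0 by convention. *)
definition mild_solution ::
  "(real \<Rightarrow> 'h \<Rightarrow> 'h) \<Rightarrow> ('h \<Rightarrow> 'h) \<Rightarrow> (real \<Rightarrow> 'h) \<Rightarrow> 'h \<Rightarrow> real \<Rightarrow>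
   (real \<Rightarrow> 'h::{real_inner, banach, second_countable_topology}) \<Rightarrow> bool" where
  "mild_solution S G g x T y \<longleftrightarrow>
     continuous_on {0..T} y \<and>
     (\<forall>t\<in>{0..T}.
        integrable (lebesgue_on {0..t}) (\<lambda>s. S (t - s) (G (y s))) \<and>
        integrable (lebesgue_on {0..t}) (\<lambda>s. S (t - s) (g s)) \<and>
        y t = S t x
          + (LINT s|lebesgue_on {0..t}. S (t - s) (G (y s)))
          + (LINT s|lebesgue_on {0..t}. S (t - s) (g s)))"

(* Functions on the whole real line of which only the values on [0,T] matter. *)
definition unique_mild_solution ::
  "(real \<Rightarrow> 'h \<Rightarrow> 'h) \<Rightarrow> ('h \<Rightarrow> 'h) \<Rightarrow> (real \<Rightarrow> 'h) \<Rightarrow> 'h \<Rightarrow> real \<Rightarrow>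
   (real \<Rightarrow> 'h::{real_inner, banach, second_countable_topology}) \<Rightarrow> bool" where
  "unique_mild_solution S G g x T y \<longleftrightarrow>
     mild_solution S G g x T y \<and>
     (\<forall>z. mild_solution S G g x T z \<longrightarrow> (\<forall>t\<in>{0..T}. z t = y t))"

(* Representatives of the classes in L^q(0,T;V), for finite q. *)
definition Lq_fun ::
  "real \<Rightarrow> real \<Rightarrow> (real \<Rightarrow> 'v::{real_normed_vector, second_countable_topology}) set" where
  "Lq_fun q T = {f. f \<in> borel_measurable (lebesgue_on {0..T}) \<and>
                    integrable (lebesgue_on {0..T}) (\<lambda>s. norm (f s) powr q)}"

definition admissible_controls ::
  "real \<Rightarrow> 'v set \<Rightarrow> real \<Rightarrow> (real \<Rightarrow> 'v::{real_normed_vector, second_countable_topology}) set" where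
  "admissible_controls q U T = {f \<in> Lq_fun q T. AE s in lebesgue_on {0..T}. f s \<in> U}"

end

theory Submission
  imports Defs
begin

text \<open>Let \<open>S\<close> be the semigroup, \<open>E\<^sub>N(t) = T\<^sub>N(t) \<Pi>\<^sub>N\<close>, and \<open>\<phi>\<close> an orbit mean
  \<open>(1/h) \<integral>\<^sub>0\<^sup>h S(r) x dr\<close>. Orbit means are dense and lie in the domain of \<open>L\<close>. Differentiating
  \<open>E\<^sub>N(t - s) S(s) \<phi>\<close> in \<open>s\<close> reduces \<open>E\<^sub>N(t) \<phi> \<rightarrow> S(t) \<phi>\<close> to the consistency
  assumption, which the uniform boundedness principle makes uniform on compact orbits. Hence
  \<open>E\<^sub>N(t) z \<rightarrow> S(t) z\<close> uniformly for \<open>t \<in> [0,T]\<close> and \<open>z\<close> in a compact set.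
  By assumption (e) the set \<open>Y\<close> of all values \<open>y(t; x, u)\<close> is totally bounded, so the values
  \<open>x\<close>, \<open>F(y(s))\<close> and \<open>\<C>(u(s))\<close> fed into the semigroups stay in one compact set, whatever
  the control \<open>u\<close> is. Splitting the nonlinear term as
  \<open>E\<^sub>N F(y\<^sub>N) - S F(y) = E\<^sub>N (F(y\<^sub>N) - F(y)) + (E\<^sub>N - S) F(y)\<close>, Gronwall's inequality gives an
  error bound that does not depend on \<open>u\<close>.\<close>

subsection \<open>Uniform boundedness and compactness\<close>

text \<open>Baire category: the closed sets \<open>Z m\<close> cover the space, so one of them
  contains a ball, and differences of points of that ball carry its bound over to every
  direction.\<close>

lemma uniform_boundedness_principle:
  fixes A :: "nat \<Rightarrow> 'a::banach \<Rightarrow>\<^sub>L 'b::real_normed_vector"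
  assumes bounded: "\<And>x. \<exists>c. \<forall>n. norm (A n x) \<le> c"
  shows "\<exists>K. \<forall>n. norm (A n) \<le> K"
proof -
  define Z where "Z m = {x. \<forall>n. norm (A n x) \<le> real m}" for m
  have "closed (Z m)" for m
  proof -
    have "Z m = (\<Inter>n. {x. norm (A n x) \<le> real m})"
      by (auto simp: Z_def)
    moreover have "closed {x. norm (A n x) \<le> real m}" for n
      by (intro closed_Collect_le continuous_intros)
    ultimately show ?thesis
      by auto
  qed
  moreover have "\<Union>(range Z) = UNIV"
  proof -
    have "\<exists>m. x \<in> Z m" for x
    proof -
      obtain c where "\<And>n. norm (A n x) \<le> c"
        using bounded by blast
      moreover obtain m where "c \<le> real m"
        using real_arch_simple by blast
      ultimately show ?thesis
        unfolding Z_def by (blast intro: order_trans)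
    qed
    then show ?thesis by blast
  qed
  ultimately have "\<exists>m. interior (Z m) \<noteq> {}"
    using Baire_category_alt[of "euclidean :: 'a topology" "range Z"]
    by (auto simp: completely_metrizable_space_euclidean)
  then obtain m z r where r: "r > 0" "cball z r \<subseteq> Z m"
    by (metis ex_in_conv mem_interior_cball)
  have "norm (A n) \<le> 2 * real m / r" for n
  proof (rule norm_blinfun_bound)
    show "0 \<le> 2 * real m / r" using r by simp
    fix x
    show "norm (A n x) \<le> 2 * real m / r * norm x"
    proof (cases "x = 0")
      case False
      \<comment> \<open>Rescaling to length \<open>r\<close> keeps \<open>z + w\<close> in the ball,
        so \<open>A n w\<close> is a difference of two vectors of norm at most
        \<open>m\<close>.\<close>
      define w where "w = (r / norm x) *\<^sub>R x"
      have "norm w = r"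
        using False r by (simp add: w_def)
      then have "z \<in> Z m" "z + w \<in> Z m"
        using r by (auto simp: subset_iff mem_cball dist_norm)
      then have "norm (A n z) \<le> real m" "norm (A n (z + w)) \<le> real m"
        by (auto simp: Z_def)
      then have "norm (A n w) \<le> 2 * real m"
        using norm_triangle_ineq4[of "A n (z + w)" "A n z"] by (simp add: blinfun.add_right)
      moreover have "norm (A n w) = r / norm x * norm (A n x)"
        using r by (simp add: w_def blinfun.scaleR_right)
      ultimately show ?thesis
        using False r by (simp add: field_simps)
    qed auto
  qed
  then show ?thesis by blast
qed

text \<open>On a finite net of \<open>X\<close> the pointwise smallness is simultaneous, and a
  Lipschitz constant common to all \<open>n\<close> and \<open>i\<close> covers the distance to the
  net.\<close>

lemma uniformly_small_on_compact:
  fixes A :: "nat \<Rightarrow> 'i \<Rightarrow> 'a::real_normed_vector \<Rightarrow> 'b::real_normed_vector"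
  assumes X: "compact X"
    and small: "\<And>z e. e > 0 \<Longrightarrow> \<forall>\<^sub>F n in sequentially. \<forall>i\<in>I. norm (A n i z) \<le> e"
    and lip: "\<forall>\<^sub>F n in sequentially. \<forall>i\<in>I. \<forall>z w. norm (A n i z - A n i w) \<le> K * norm (z - w)"
    and e: "e > 0"
  shows "\<forall>\<^sub>F n in sequentially. \<forall>i\<in>I. \<forall>z\<in>X. norm (A n i z) \<le> e"
proof -
  \<comment> \<open>Chosen so that \<open>(\<bar>K\<bar> + 1) * d = e / 2\<close>; the summand 1
    keeps the denominator positive whatever \<open>K\<close> is.\<close>
  define d where "d = e / (2 * (\<bar>K\<bar> + 1))"
  have d: "d > 0" using e by (simp add: d_def field_simps add_nonneg_pos)
  then obtain k where k: "finite k" "X \<subseteq> (\<Union>x\<in>k. ball x d)"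
    using X by (auto simp: compact_eq_totally_bounded)
  have "\<forall>\<^sub>F n in sequentially. \<forall>w\<in>k. \<forall>i\<in>I. norm (A n i w) \<le> e / 2"
    using k(1) small[of "e / 2"] e by (intro eventually_ball_finite) auto
  then show ?thesis
    using lip
  proof eventually_elim
    case (elim n)
    show ?case
    proof (intro ballI)
      fix i z
      assume i: "i \<in> I" and "z \<in> X"
      then obtain w where w: "w \<in> k" "norm (z - w) < d"
        using k(2) by (force simp: dist_norm norm_minus_commute)
      have "norm (A n i z - A n i w) \<le> K * norm (z - w)"
        using elim i by blast
      also have "\<dots> \<le> (\<bar>K\<bar> + 1) * d"
        using w by (intro mult_mono) auto
      also have "\<dots> = e / 2"
        by (simp add: d_def add_nonneg_pos field_simps)
      finally show "norm (A n i z) \<le> e"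
        using elim i w norm_triangle_ineq2[of "A n i z" "A n i w"] by force
    qed
  qed
qed

section \<open>Compactness by approximation\<close>

text \<open>Each new vector adds a segment, and a sum of two compact sets is compact. These sets
  will contain the projections of bounded sets.\<close>

lemma compact_bounded_combinations:
  fixes C :: "'a::real_normed_vector set"
  assumes "finite C"
  shows "compact {\<Sum>c\<in>C. a c *\<^sub>R c | a. \<forall>c\<in>C. \<bar>a c\<bar> \<le> (R::real)}"
  using assms
proof (induction C rule: finite_induct)
  case empty
  then show ?case by simp
next
  case (insert c C)
  let ?Z = "\<lambda>C. {\<Sum>c\<in>C. a c *\<^sub>R c | a. \<forall>c\<in>C. \<bar>a c\<bar> \<le> R}"
  have "?Z (insert c C) = {v + w | v w. v \<in> (\<lambda>r. r *\<^sub>R c) ` {-R..R} \<and> w \<in> ?Z C}"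
  proof (intro equalityI subsetI)
    fix v
    assume "v \<in> {v + w | v w. v \<in> (\<lambda>r. r *\<^sub>R c) ` {-R..R} \<and> w \<in> ?Z C}"
    then obtain r a where ra: "r \<in> {-R..R}" "\<forall>c\<in>C. \<bar>a c\<bar> \<le> R"
      "v = r *\<^sub>R c + (\<Sum>c\<in>C. a c *\<^sub>R c)"
      by blast
    have "(\<Sum>d\<in>insert c C. (a(c := r)) d *\<^sub>R d) = v"
    proof -
      have "(\<Sum>d\<in>C. (a(c := r)) d *\<^sub>R d) = (\<Sum>c\<in>C. a c *\<^sub>R c)"
        using insert by (intro sum.cong) auto
      then show ?thesis
        using insert ra by simp
    qed
    moreover have "\<forall>d\<in>insert c C. \<bar>(a(c := r)) d\<bar> \<le> R"
      using ra by auto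
    ultimately show "v \<in> ?Z (insert c C)"
      by (intro CollectI exI[of _ "a(c := r)"] conjI) (simp_all only:)
  next
    fix v
    assume "v \<in> ?Z (insert c C)"
    then obtain a where a: "\<forall>d\<in>insert c C. \<bar>a d\<bar> \<le> R" "v = (\<Sum>d\<in>insert c C. a d *\<^sub>R d)"
      by blast
    then have "v = a c *\<^sub>R c + (\<Sum>d\<in>C. a d *\<^sub>R d)" "a c \<in> {-R..R}"
      using insert.hyps by (auto simp: abs_le_iff)
    then show "v \<in> {v + w | v w. v \<in> (\<lambda>r. r *\<^sub>R c) ` {-R..R} \<and> w \<in> ?Z C}"
      using a(1) by blast
  qed
  moreover have "compact ((\<lambda>r. r *\<^sub>R c) ` {-R..R})"
    by (intro compact_continuous_image continuous_intros) auto
  ultimately show ?case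
    using compact_sums[OF _ insert.IH] by (simp only:)
qed

text \<open>A finite net of a compact approximant is a coarser net of \<open>closure X\<close>:
  passing to \<open>X\<close>, to \<open>Z\<close> and to the net costs at most \<open>e / 4\<close>
  each. The approximant may vary with \<open>e\<close>, as the Galerkin index will.\<close>

lemma compact_closure_if_near_compact:
  fixes X :: "'a::banach set"
  assumes near: "\<And>e. e > 0 \<Longrightarrow> \<exists>Z. compact Z \<and> (\<forall>x\<in>X. \<exists>z\<in>Z. norm (x - z) \<le> e)"
  shows "compact (closure X)"
  unfolding compact_eq_totally_bounded
proof (intro conjI allI impI)
  show "complete (closure X)"
    by (simp add: complete_eq_closed)
  fix e :: real
  assume e: "e > 0"
  then obtain Z where Z: "compact Z" "\<And>x. x \<in> X \<Longrightarrow> \<exists>z\<in>Z. norm (x - z) \<le> e / 4"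
    using near[of "e / 4"] by auto
  then obtain k where k: "finite k" "Z \<subseteq> (\<Union>x\<in>k. ball x (e / 4))"
    using e unfolding compact_eq_totally_bounded by (meson zero_less_divide_iff zero_less_numeral)
  have "x \<in> (\<Union>x\<in>k. ball x e)" if x: "x \<in> closure X" for x
  proof -
    obtain x' where x': "x' \<in> X" "dist x' x < e / 4"
      using x e closure_approachable[of x X] by (metis divide_pos_pos zero_less_numeral)
    then obtain z where z: "z \<in> Z" "norm (x' - z) \<le> e / 4"
      using Z by blast
    then obtain w where w: "w \<in> k" "dist w z < e / 4"
      using k by force
    have "dist w x \<le> dist w z + dist z x' + dist x' x"
      using dist_triangle[of w x z] dist_triangle[of z x x'] by linarith
    then have "dist w x < e"
      using x' z w e by (simp add: dist_norm norm_minus_commute)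
    then show ?thesis using w by auto
  qed
  then show "\<exists>k. finite k \<and> closure X \<subseteq> (\<Union>x\<in>k. ball x e)"
    using k by blast
qed

section \<open>A Gronwall inequality\<close>

text \<open>The maximum of \<^term>\<open>exp (- (2 * b * s)) * \<phi> s\<close> is at most \<^term>\<open>2 * a\<close>: the weight makes the
  integral operator a contraction with constant 1/2.\<close>

lemma gronwall_le:
  fixes \<phi> :: "real \<Rightarrow> real"
  assumes cont: "continuous_on {0..T} \<phi>" and T: "0 \<le> T" and b: "0 < b"
    and le: "\<And>t. t \<in> {0..T} \<Longrightarrow> \<phi> t \<le> a + b * integral {0..t} \<phi>"
    and t: "t \<in> {0..T}" and a: "0 \<le> a"
  shows "\<phi> t \<le> 2 * a * exp (2 * b * T)"
proof -
  define \<psi> where "\<psi> s = exp (- (2 * b * s)) * \<phi> s" for s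
  have "continuous_on {0..T} \<psi>"
    unfolding \<psi>_def by (intro continuous_intros cont)
  then obtain r where r: "r \<in> {0..T}" "\<And>s. s \<in> {0..T} \<Longrightarrow> \<psi> s \<le> \<psi> r"
    using continuous_attains_sup[of "{0..T}" \<psi>] T by auto
  have \<phi>_le: "\<phi> s \<le> \<psi> r * exp (2 * b * s)" if "s \<in> {0..T}" for s
    using r(2)[OF that] by (simp add: \<psi>_def exp_minus field_simps)
  have "((\<lambda>s. exp (2 * b * s)) has_integral exp (2 * b * r) / (2 * b) - exp (2 * b * 0) / (2 * b)) {0..r}"
    using r b by (intro fundamental_theorem_of_calculus)
      (auto intro!: derivative_eq_intros simp flip: has_real_derivative_iff_has_vector_derivative)
  from has_integral_mult_right[OF this, of "\<psi> r"]
  have I: "((\<lambda>s. \<psi> r * exp (2 * b * s)) has_integral \<psi> r * (exp (2 * b * r) - 1) / (2 * b)) {0..r}"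
    by (simp add: diff_divide_distrib right_diff_distrib)
  have "\<phi> integrable_on {0..r}"
    using r by (intro integrable_continuous_real continuous_on_subset[OF cont]) auto
  then have "integral {0..r} \<phi> \<le> \<psi> r * (exp (2 * b * r) - 1) / (2 * b)"
    using r by (intro has_integral_le[OF integrable_integral I]) (auto intro: \<phi>_le)
  then have "b * integral {0..r} \<phi> \<le> \<psi> r * (exp (2 * b * r) - 1) / 2"
    using b by (simp add: field_simps)
  then have *: "\<phi> r \<le> a + \<psi> r * (exp (2 * b * r) - 1) / 2"
    using le[OF r(1)] by linarith
  have \<phi>r: "\<phi> r = \<psi> r * exp (2 * b * r)"
    by (simp add: \<psi>_def exp_minus)
  \<comment> \<open>Since \<open>\<phi> r = \<psi> r * exp (2 * b * r)\<close>, the bound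
    \<open>*\<close> amounts to \<open>\<phi> r + \<psi> r \<le> 2 * a\<close>. If
    \<open>\<psi> r\<close> exceeded \<open>2 * a\<close> it would be positive, so
    \<open>\<phi> r \<ge> \<psi> r\<close>, which is a contradiction.\<close>
  have "\<psi> r \<le> 2 * a"
  proof (rule ccontr)
    assume neg: "\<not> \<psi> r \<le> 2 * a"
    have "\<psi> r * 1 \<le> \<psi> r * exp (2 * b * r)"
      using r b a neg by (intro mult_left_mono) auto
    then have "\<psi> r \<le> \<psi> r * exp (2 * b * r)"
      by (simp only: mult_1_right)
    then show False
      using * \<phi>r neg a unfolding right_diff_distrib diff_divide_distrib by linarith
  qed
  then have "\<phi> t \<le> 2 * a * exp (2 * b * t)"
    using \<phi>_le[OF t] by (meson exp_ge_zero mult_right_mono order_trans)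
  also have "\<dots> \<le> 2 * a * exp (2 * b * T)"
    using t b a by (intro mult_left_mono) auto
  finally show ?thesis .
qed

subsection \<open>The exponential of a bounded operator\<close>

text \<open>The iterate of \<open>(o\<^sub>L) B\<close> at the identity is the power of
  \<open>B\<close>. Summing operators, rather than pointwise as in \<open>exp_flow\<close>, gives an
  operator-valued function of \<open>t\<close>, to which the product rule with a moving argument
  applies.\<close>

definition exp_blinfun :: "('a::banach \<Rightarrow>\<^sub>L 'a) \<Rightarrow> real \<Rightarrow> 'a \<Rightarrow>\<^sub>L 'a" where
  "exp_blinfun B t = (\<Sum>n. (t ^ n / fact n) *\<^sub>R ((o\<^sub>L) B ^^ n) id_blinfun)"

lemma blinfun_power_apply: "blinfun_apply (((o\<^sub>L) B ^^ n) id_blinfun) x = (blinfun_apply B ^^ n) x"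
  for B :: "'a::real_normed_vector \<Rightarrow>\<^sub>L 'a"
  by (induction n) auto

lemma blinfun_power_Suc: "((o\<^sub>L) B ^^ Suc n) id_blinfun = ((o\<^sub>L) B ^^ n) id_blinfun o\<^sub>L B"
  for B :: "'a::real_normed_vector \<Rightarrow>\<^sub>L 'a"
  by (rule blinfun_eqI) (simp only: blinfun_power_apply blinfun_apply_blinfun_compose,
      simp only: funpow_Suc_right o_apply)

lemma norm_blinfun_power_le: "norm (((o\<^sub>L) B ^^ n) id_blinfun) \<le> norm B ^ n"
  for B :: "'a::real_normed_vector \<Rightarrow>\<^sub>L 'a"
proof (induction n)
  case 0
  then show ?case by (simp add: norm_blinfun_id_le)
next
  case (Suc n)
  have "norm (((o\<^sub>L) B ^^ Suc n) id_blinfun) \<le> norm B * norm (((o\<^sub>L) B ^^ n) id_blinfun)"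
    by (simp add: norm_blinfun_compose)
  also have "\<dots> \<le> norm B * norm B ^ n"
    by (rule mult_left_mono[OF Suc norm_ge_zero])
  finally show ?case
    by simp
qed

lemma norm_exp_blinfun_term_le:
  fixes B :: "'a::real_normed_vector \<Rightarrow>\<^sub>L 'a"
  assumes "\<bar>t\<bar> \<le> R"
  shows "norm ((t ^ n / fact n) *\<^sub>R ((o\<^sub>L) B ^^ n) id_blinfun) \<le> (R * norm B) ^ n / fact n"
proof -
  have "\<bar>t\<bar> ^ n * norm (((o\<^sub>L) B ^^ n) id_blinfun) \<le> R ^ n * norm B ^ n"
    using assms by (intro mult_mono power_mono norm_blinfun_power_le) auto
  then show ?thesis
    by (simp add: power_abs power_mult_distrib divide_right_mono)
qed

lemma summable_exp_blinfun: "summable (\<lambda>n. (t ^ n / fact n) *\<^sub>R ((o\<^sub>L) B ^^ n) id_blinfun)"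
  for B :: "'a::banach \<Rightarrow>\<^sub>L 'a"
proof (rule summable_comparison_test')
  show "summable (\<lambda>n. (\<bar>t\<bar> * norm B) ^ n / fact n)"
    using summable_exp[of "\<bar>t\<bar> * norm B"] by (simp add: field_simps)
  show "norm ((t ^ n / fact n) *\<^sub>R ((o\<^sub>L) B ^^ n) id_blinfun) \<le> (\<bar>t\<bar> * norm B) ^ n / fact n" for n
    by (rule norm_exp_blinfun_term_le) simp
qed

text \<open>Evaluation at \<open>x\<close> is bounded and linear on operators, so it passes through
  the convergent series.\<close>

lemma exp_blinfun_apply: "blinfun_apply (exp_blinfun B t) x = exp_flow (blinfun_apply B) t x"
proof -
  have "bounded_linear (\<lambda>A. blinfun_apply A x)" for x :: 'a
    by (rule bounded_linear_apply_blinfun)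
  from bounded_linear.suminf[OF this summable_exp_blinfun]
  show ?thesis
    by (simp add: exp_blinfun_def exp_flow_def blinfun.scaleR_left blinfun_power_apply)
qed

text \<open>Termwise differentiation: on a bounded interval the differentiated series converges
  uniformly, being dominated by a multiple of the exponential series of
  \<open>R * norm B\<close>.\<close>

lemma exp_blinfun_has_vector_derivative:
  "(exp_blinfun B has_vector_derivative exp_blinfun B t o\<^sub>L B) (at t)"
proof -
  \<comment> \<open>Any bounded open interval around \<open>t\<close> would do; this one gives
    majorants independent of the point.\<close>
  define R where "R = \<bar>t\<bar> + 1"
  define P where "P n = ((o\<^sub>L) B ^^ n) id_blinfun" for n
  \<comment> \<open>The constant term of the exponential has derivative 0, so the differentiated
    series is shifted by one index and its last factor \<open>B\<close> can be split off on the
    right.\<close>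
  define f' where "f' n s = (case n of 0 \<Rightarrow> 0 | Suc m \<Rightarrow> (s ^ m / fact m) *\<^sub>R P n)" for n and s :: real
  let ?I = "{-R<..<R}"
  have "uniform_limit ?I (\<lambda>n s. \<Sum>i<n. f' i s) (\<lambda>s. \<Sum>i. f' i s) sequentially"
  proof (rule Weierstrass_m_test)
    show "norm (f' n s) \<le> (case n of 0 \<Rightarrow> 0 | Suc m \<Rightarrow> (R * norm B) ^ m / fact m * norm B)"
      if "s \<in> ?I" for n s
    proof (cases n)
      case (Suc m)
      have "f' n s = ((s ^ m / fact m) *\<^sub>R P m) o\<^sub>L B"
        unfolding f'_def Suc P_def
        by (simp only: nat.case blinfun_power_Suc bounded_bilinear.scaleR_left[OF bounded_bilinear_blinfun_compose])
      then have "norm (f' n s) \<le> norm ((s ^ m / fact m) *\<^sub>R P m) * norm B"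
        by (simp only: norm_blinfun_compose)
      also have "\<dots> \<le> (R * norm B) ^ m / fact m * norm B"
        unfolding P_def using that by (intro mult_right_mono norm_exp_blinfun_term_le) auto
      finally show ?thesis using Suc by simp
    qed (simp add: f'_def)
    show "summable (\<lambda>n. case n of 0 \<Rightarrow> 0 | Suc m \<Rightarrow> (R * norm B) ^ m / fact m * norm B)"
      using summable_mult2[OF summable_exp[of "R * norm B"], of "norm B"]
      by (subst summable_Suc_iff[symmetric]) (simp add: field_simps)
  qed
  note lim = this
  have "\<exists>g. \<forall>s\<in>?I. (\<lambda>n. (s ^ n / fact n) *\<^sub>R P n) sums g s \<and>
          (g has_derivative (\<lambda>h. h *\<^sub>R (\<Sum>i. f' i s))) (at s within ?I)"
  proof (rule has_derivative_series[where x = 0 and l = "exp_blinfun B 0"])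
    show "((\<lambda>s. (s ^ n / fact n) *\<^sub>R P n) has_derivative (\<lambda>h. h *\<^sub>R f' n s)) (at s within ?I)" for n s
    proof -
      have "((\<lambda>s. s ^ n / fact n) has_real_derivative (case n of 0 \<Rightarrow> 0 | Suc m \<Rightarrow> s ^ m / fact m)) (at s within ?I)"
      proof (cases n)
        case (Suc m)
        have "real (Suc m) * s ^ m / fact (Suc m) = s ^ m / fact m"
          by (simp del: of_nat_Suc)
        moreover have "((\<lambda>s. s ^ Suc m / fact (Suc m)) has_real_derivative real (Suc m) * s ^ m / fact (Suc m)) (at s within ?I)"
          by (rule derivative_eq_intros refl | simp)+
        ultimately show ?thesis using Suc by simp
      qed simp
      from has_vector_derivative_scaleR[OF this has_vector_derivative_const[of "P n"]]
      show ?thesis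
        by (simp add: has_vector_derivative_def f'_def split: nat.splits)
    qed
    show "(\<lambda>n. (0 ^ n / fact n) *\<^sub>R P n) sums exp_blinfun B 0"
      unfolding P_def exp_blinfun_def by (rule summable_sums[OF summable_exp_blinfun])
    fix e :: real
    assume "e > 0"
    with lim have "\<forall>\<^sub>F n in sequentially. \<forall>s\<in>?I. norm ((\<Sum>i<n. f' i s) - (\<Sum>i. f' i s)) < e"
      by (simp add: uniform_limit_iff dist_norm)
    then show "\<forall>\<^sub>F n in sequentially. \<forall>s\<in>?I. \<forall>h.
        norm ((\<Sum>i<n. h *\<^sub>R f' i s) - h *\<^sub>R (\<Sum>i. f' i s)) \<le> e * norm h"
    proof eventually_elim
      case (elim n)
      show ?case
      proof (intro ballI allI)
        fix s h assume "s \<in> ?I"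
        then have "\<bar>h\<bar> * norm ((\<Sum>i<n. f' i s) - (\<Sum>i. f' i s)) \<le> \<bar>h\<bar> * e"
          using elim by (intro mult_left_mono) (auto intro: less_imp_le)
        then show "norm ((\<Sum>i<n. h *\<^sub>R f' i s) - h *\<^sub>R (\<Sum>i. f' i s)) \<le> e * norm h"
          by (simp add: mult.commute flip: scaleR_sum_right scaleR_diff_right)
      qed
    qed
  qed (auto simp: R_def)
  then obtain g where g: "\<And>s. s \<in> ?I \<Longrightarrow> (\<lambda>n. (s ^ n / fact n) *\<^sub>R P n) sums g s"
    "\<And>s. s \<in> ?I \<Longrightarrow> (g has_derivative (\<lambda>h. h *\<^sub>R (\<Sum>i. f' i s))) (at s within ?I)"
    by blast
  have geq: "g s = exp_blinfun B s" if "s \<in> ?I" for s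
    using g(1)[OF that] by (simp add: exp_blinfun_def P_def sums_iff)
  have t: "t \<in> ?I" by (auto simp: R_def)
  have "(\<lambda>i. f' i t) sums (exp_blinfun B t o\<^sub>L B)"
  proof -
    have "(\<lambda>m. (t ^ m / fact m) *\<^sub>R P m) sums exp_blinfun B t"
      unfolding P_def exp_blinfun_def by (rule summable_sums[OF summable_exp_blinfun])
    from bounded_linear.sums[OF bounded_bilinear.bounded_linear_left[OF bounded_bilinear_blinfun_compose] this, of B]
    have "(\<lambda>m. f' (Suc m) t) sums (exp_blinfun B t o\<^sub>L B)"
      unfolding f'_def P_def nat.case blinfun_power_Suc
      by (simp only: bounded_bilinear.scaleR_left[OF bounded_bilinear_blinfun_compose])
    then show ?thesis
      by (subst (asm) sums_Suc_iff) (simp add: f'_def)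
  qed
  then have "(\<Sum>i. f' i t) = exp_blinfun B t o\<^sub>L B"
    by (simp add: sums_iff)
  then have "(g has_vector_derivative exp_blinfun B t o\<^sub>L B) (at t within ?I)"
    using g(2)[OF t] by (simp add: has_vector_derivative_def)
  moreover have "at t within ?I = at t"
    using t by (intro at_within_open) auto
  ultimately have "(g has_vector_derivative exp_blinfun B t o\<^sub>L B) (at t)"
    by simp
  then show ?thesis
    by (rule has_vector_derivative_transform_within_open[where S = ?I]) (use t geq in auto)
qed

subsection \<open>Orbits of a strongly continuous semigroup\<close>

text \<open>Translates a derivative within an interval into the one-sided quotient that defines the
  generator.\<close>

lemma right_difference_quotient_tendsto:
  assumes f: "(f has_vector_derivative D) (at 0 within {0..b})" and b: "0 < b"
  shows "((\<lambda>h. (f h - f 0) /\<^sub>R h) \<longlongrightarrow> D) (at_right 0)"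
proof -
  have "((\<lambda>h. norm (f h - f 0 - h *\<^sub>R D) / \<bar>h\<bar>) \<longlongrightarrow> 0) (at_right 0)"
    using f b by (simp add: has_vector_derivative_def has_derivative_iff_norm at_within_Icc_at_right)
  moreover have eq: "norm (f h - f 0 - h *\<^sub>R D) / \<bar>h\<bar> = norm ((f h - f 0) /\<^sub>R h - D)"
    if "h \<noteq> 0" for h
  proof -
    have "(f h - f 0) /\<^sub>R h - D = (f h - f 0 - h *\<^sub>R D) /\<^sub>R h"
      using that by (simp add: scaleR_diff_right)
    then show ?thesis by (simp add: divide_inverse_commute)
  qed
  ultimately have "((\<lambda>h. norm ((f h - f 0) /\<^sub>R h - D)) \<longlongrightarrow> 0) (at_right 0)"
    by (elim Lim_transform_eventually)
      (unfold eventually_at_filter, intro always_eventually allI impI eq)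
  then show ?thesis
    by (rule Lim_null[THEN iffD2, OF tendsto_norm_zero_cancel])
qed

text \<open>Serves both for \<open>S\<close> and, with the same constants, for every
  \<open>SN N\<close>.\<close>

locale c0_semigroup_growth =
  fixes S :: "real \<Rightarrow> 'a::banach \<Rightarrow>\<^sub>L 'a" and M \<omega> :: real
  assumes c0: "c0_semigroup S"
    and growth: "\<And>t. t \<ge> 0 \<Longrightarrow> norm (S t) \<le> M * exp (\<omega> * t)"
    and M: "M \<ge> 1" and \<omega>: "\<omega> \<ge> 0"
begin

lemma S_0 [simp]: "S 0 x = x"
  using c0 by (simp add: c0_semigroup_def)

lemma S_add: "s \<ge> 0 \<Longrightarrow> t \<ge> 0 \<Longrightarrow> S (s + t) x = S s (S t x)"
  using c0 by (simp add: c0_semigroup_def)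

lemma S_tendsto: "((\<lambda>t. S t x) \<longlongrightarrow> x) (at_right 0)"
  using c0 by (simp add: c0_semigroup_def)

lemma norm_S_le:
  assumes "0 \<le> t" "t \<le> T"
  shows "norm (S t x) \<le> M * exp (\<omega> * T) * norm x"
proof -
  have "norm (S t x) \<le> norm (S t) * norm x"
    by (rule norm_blinfun)
  also have "\<dots> \<le> M * exp (\<omega> * t) * norm x"
    using assms by (intro mult_right_mono growth) auto
  also have "\<dots> \<le> M * exp (\<omega> * T) * norm x"
    using assms M \<omega> by (intro mult_right_mono mult_left_mono) (auto intro!: mult_left_mono)
  finally show ?thesis .
qed

lemma continuous_on_S: "continuous_on {0..T} (\<lambda>t. S t x)"
  unfolding continuous_on_iff
proof (intro ballI allI impI)
  fix s e :: real
  assume s: "s \<in> {0..T}" and e: "e > 0"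
  define K where "K = M * exp (\<omega> * T)"
  have K: "K > 0" using M by (auto simp: K_def)
  then have "\<forall>\<^sub>F h in at_right 0. dist (S h x) x < e / K"
    using S_tendsto e by (intro tendstoD) auto
  then obtain d where d: "d > 0" "\<And>h. 0 < h \<Longrightarrow> h < d \<Longrightarrow> dist (S h x) x < e / K"
    by (auto simp: eventually_at_right_field)
  \<comment> \<open>Factoring out \<open>S s\<close> reduces the increment to right continuity at 0.
    Exchanging the two times gives left continuity, because the bound \<open>K\<close> on
    \<open>S s\<close> is valid on the whole interval.\<close>
  have *: "dist (S t x) (S s x) < e" if "0 \<le> s" "s \<le> t" "t \<le> T" "t - s < d" for s t
  proof (cases "s = t")
    case False
    have "S t x - S s x = S s (S (t - s) x - x)"
      using S_add[of s "t - s" x] that by (simp add: blinfun.diff_right)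
    then have "dist (S t x) (S s x) \<le> K * dist (S (t - s) x) x"
      using norm_S_le[of s T "S (t - s) x - x"] that by (simp add: dist_norm K_def)
    also have "\<dots> < K * (e / K)"
      using that False K by (intro mult_strict_left_mono d) auto
    finally show ?thesis using K by auto
  qed (use e in auto)
  show "\<exists>d>0. \<forall>t\<in>{0..T}. dist t s < d \<longrightarrow> dist (S t x) (S s x) < e"
  proof (intro exI[of _ d] conjI ballI impI)
    fix t assume t: "t \<in> {0..T}" "dist t s < d"
    show "dist (S t x) (S s x) < e"
    proof (cases "s \<le> t")
      case True
      then show ?thesis using * s t by (auto simp: dist_real_def)
    next
      case False
      then show ?thesis using *[of t s] s t by (auto simp: dist_real_def dist_commute)
    qed
  qed (fact d)
qed

lemma S_integrable: "0 \<le> a \<Longrightarrow> (\<lambda>t. S t x) integrable_on {a..b}"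
  by (intro integrable_continuous_real continuous_on_subset[OF continuous_on_S[of b]]) auto

text \<open>A smoothing average: bounded in \<open>x\<close>, close to \<open>x\<close> for small
  \<open>h\<close>, and with values in the domain of the generator.\<close>

definition orbit_mean :: "real \<Rightarrow> 'a \<Rightarrow> 'a" where
  "orbit_mean h x = (1 / h) *\<^sub>R integral {0..h} (\<lambda>t. S t x)"

lemma bounded_linear_orbit_mean:
  assumes h: "h > 0"
  shows "bounded_linear (orbit_mean h)"
proof
  show "orbit_mean h (x + z) = orbit_mean h x + orbit_mean h z" for x z
    by (simp add: orbit_mean_def blinfun.add_right integral_add S_integrable scaleR_add_right)
  show "orbit_mean h (r *\<^sub>R x) = r *\<^sub>R orbit_mean h x" for r x
    by (simp add: orbit_mean_def blinfun.scaleR_right)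
  have "norm (orbit_mean h x) \<le> norm x * (M * exp (\<omega> * h))" for x
  proof -
    have "norm (integral {0..h} (\<lambda>t. S t x)) \<le> integral {0..h} (\<lambda>t. M * exp (\<omega> * h) * norm x)"
      by (intro integral_norm_bound_integral S_integrable) (auto intro: norm_S_le)
    then show ?thesis
      using h by (simp add: orbit_mean_def field_simps)
  qed
  then show "\<exists>K. \<forall>x. norm (orbit_mean h x) \<le> norm x * K"
    by blast
qed

text \<open>\<open>S s\<close> passes under the integral. The first form moves the time onto the
  orbit of \<open>x\<close>; the second moves it into the limits of integration, where it can be
  differentiated.\<close>

lemma S_orbit_mean:
  assumes "s \<ge> 0" "h > 0"
  shows "S s (orbit_mean h x) = orbit_mean h (S s x)"
    and "S s (orbit_mean h x) =
      (1 / h) *\<^sub>R (integral {0..s + h} (\<lambda>t. S t x) - integral {0..s} (\<lambda>t. S t x))"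
proof -
  have 1: "S s (integral {0..h} (\<lambda>t. S t x)) = integral {0..h} (\<lambda>t. S s (S t x))"
    using integral_linear[OF S_integrable[of 0 x h] blinfun.bounded_linear_right[of "S s"]]
    by (simp add: o_def)
  also have "\<dots> = integral {0..h} (\<lambda>t. S t (S s x))"
    using assms by (intro integral_cong) (simp add: add.commute flip: S_add)
  finally show "S s (orbit_mean h x) = orbit_mean h (S s x)"
    by (simp add: orbit_mean_def blinfun.scaleR_right)
  have "integral {0..h} (\<lambda>t. S s (S t x)) = integral {0..h} ((\<lambda>t. S t x) \<circ> (+) s)"
    using assms by (intro integral_cong) (simp flip: S_add)
  also have "\<dots> = integral {0 + s..h + s} (\<lambda>t. S t x)"
    by (simp add: integral_shift_Icc_real)
  also have "\<dots> = integral {0..s + h} (\<lambda>t. S t x) - integral {0..s} (\<lambda>t. S t x)"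
    using assms Henstock_Kurzweil_Integration.integral_combine[where a = 0 and c = s and b = "s + h", OF _ _ S_integrable]
    by (simp add: algebra_simps)
  finally show "S s (orbit_mean h x) =
      (1 / h) *\<^sub>R (integral {0..s + h} (\<lambda>t. S t x) - integral {0..s} (\<lambda>t. S t x))"
    using 1 by (simp add: orbit_mean_def blinfun.scaleR_right)
qed

text \<open>Only the limits of integration depend on \<open>s\<close>, so the fundamental theorem of
  calculus at both ends gives the derivative.\<close>

lemma S_orbit_mean_has_vector_derivative:
  assumes h: "h > 0" and s: "s \<in> {0..T}"
  shows "((\<lambda>s. S s (orbit_mean h x)) has_vector_derivative (S h (S s x) - S s x) /\<^sub>R h)
           (at s within {0..T})"
proof -
  let ?G = "\<lambda>s. integral {0..s} (\<lambda>t. S t x)"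
  have G: "(?G has_vector_derivative S s x) (at s within {0..b})" if "s \<in> {0..b}" for s b
    using integral_has_vector_derivative[OF continuous_on_S that] .
  have "((\<lambda>s. s + h) has_vector_derivative 1) (at s within {0..T})"
    by (auto intro!: derivative_eq_intros)
  moreover have "(?G has_vector_derivative S (s + h) x) (at (s + h) within (\<lambda>s. s + h) ` {0..T})"
    using s h by (intro has_vector_derivative_within_subset[OF G[of "s + h" "T + h"]]) auto
  ultimately have "((?G \<circ> (\<lambda>s. s + h)) has_vector_derivative 1 *\<^sub>R S (s + h) x) (at s within {0..T})"
    by (rule vector_diff_chain_within)
  then have "((\<lambda>s. (1 / h) *\<^sub>R (?G (s + h) - ?G s)) has_vector_derivative
      (1 / h) *\<^sub>R (S (s + h) x - S s x)) (at s within {0..T})"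
    using G[OF s]
    by (intro bounded_linear.has_vector_derivative[OF bounded_linear_scaleR_right]
        has_vector_derivative_diff) (simp_all add: o_def)
  then have "((\<lambda>s. S s (orbit_mean h x)) has_vector_derivative
      (1 / h) *\<^sub>R (S (s + h) x - S s x)) (at s within {0..T})"
    by (rule has_vector_derivative_transform[rotated -1]) (use s h S_orbit_mean(2) in auto)
  moreover have "S (s + h) x = S h (S s x)"
    using s h by (simp add: add.commute[of s] S_add)
  ultimately show ?thesis
    by (simp add: divide_inverse_commute)
qed

lemma orbit_mean_tendsto: "((\<lambda>h. orbit_mean h x) \<longlongrightarrow> x) (at_right 0)"
proof -
  have "((\<lambda>u. integral {0..u} (\<lambda>t. S t x)) has_vector_derivative S 0 x) (at 0 within {0..1})"
    by (rule integral_has_vector_derivative[OF continuous_on_S]) simp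
  from right_difference_quotient_tendsto[OF this] show ?thesis
    by (simp add: orbit_mean_def divide_inverse_commute)
qed

end

subsection \<open>Orthogonal projectors on finite-dimensional subspaces\<close>

text \<open>The difference of two candidates lies in \<open>S\<close> and is orthogonal to
  \<open>S\<close>, hence to itself.\<close>

lemma orthogonal_projector_eqI:
  assumes P: "orthogonal_projector S P" and S: "subspace S"
    and w: "w \<in> S" "\<And>v. v \<in> S \<Longrightarrow> (x - w) \<bullet> v = 0"
  shows "P x = w"
proof -
  have Px: "P x \<in> S" "\<And>v. v \<in> S \<Longrightarrow> (x - P x) \<bullet> v = 0"
    using P by (auto simp: orthogonal_projector_def)
  then have "P x - w \<in> S"
    using S w by (intro subspace_diff)
  then have "(x - w) \<bullet> (P x - w) - (x - P x) \<bullet> (P x - w) = 0"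
    using Px w by simp
  then have "(P x - w) \<bullet> (P x - w) = 0"
    by (simp flip: inner_diff_left)
  then show ?thesis by simp
qed

lemma orthogonal_projector_norm_le:
  assumes "orthogonal_projector S P"
  shows "norm (P x) \<le> norm x"
proof -
  have "(x - P x) \<bullet> P x = 0"
    using assms by (auto simp: orthogonal_projector_def)
  then have "norm x ^ 2 = norm (P x) ^ 2 + norm (x - P x) ^ 2"
    using norm_add_Pythagorean[of "P x" "x - P x"] by (simp add: orthogonal_def inner_commute)
  then have "norm (P x) ^ 2 \<le> norm x ^ 2"
    by (simp only: le_add_same_cancel1 zero_le_power2)
  then show ?thesis
    by (rule power2_le_imp_le) (rule norm_ge_zero)
qed

text \<open>The expansion in an orthogonal spanning set makes linearity of \<open>P\<close> visible,
  and expresses \<open>P\<close> by finitely many scalar coefficients.\<close>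

lemma orthogonal_projector_expansion:
  assumes P: "orthogonal_projector S P" and S: "finite_dim_subspace S"
  shows "\<exists>C. finite C \<and> C \<subseteq> S \<and> (\<forall>x. P x = (\<Sum>c\<in>C. (x \<bullet> c / (c \<bullet> c)) *\<^sub>R c))"
proof -
  obtain C where C: "finite C" "span C = S" "pairwise orthogonal C"
    using S basis_orthogonal unfolding finite_dim_subspace_def by metis
  have "P x = (\<Sum>c\<in>C. (x \<bullet> c / (c \<bullet> c)) *\<^sub>R c)" (is "_ = ?w") for x
  proof (rule orthogonal_projector_eqI[OF P])
    show "subspace S" using C subspace_span by blast
    show "?w \<in> S"
      unfolding C(2)[symmetric] by (intro span_sum span_scale span_base)
    fix v assume "v \<in> S"
    then have "v \<in> span C" using C by simp
    then show "(x - ?w) \<bullet> v = 0"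
    proof (induction rule: span_induct)
      case base
      show ?case
        by (auto simp: subspace_def inner_add_right)
    next
      case (step d)
      \<comment> \<open>A zero vector in \<open>C\<close> does no harm: division by 0 yields 0, and
        \<open>x \<bullet> d\<close> is 0 as well.\<close>
      have "(\<Sum>c\<in>C. (x \<bullet> c / (c \<bullet> c)) *\<^sub>R c) \<bullet> d = (\<Sum>c\<in>C. if c = d then x \<bullet> d else 0)"
        unfolding inner_sum_left
        using C(3) step by (intro sum.cong) (auto simp: pairwise_def orthogonal_def)
      then show ?case
        using C(1) step by (simp add: inner_diff_left)
    qed
  qed
  then show ?thesis
    using C span_superset by blast
qed

subsection \<open>A Trotter--Kato theorem for the Galerkin semigroups\<close>

text \<open>\<open>SN N\<close> is tied to the Galerkin flow only on \<open>HN N\<close>, which is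
  why the convergence results concern \<open>SN N t (Proj N x)\<close>.\<close>

locale galerkin_approximation = c0_semigroup_growth S M \<omega>
  for S :: "real \<Rightarrow> 'h::{real_inner, banach} \<Rightarrow>\<^sub>L 'h" and M \<omega> :: real +
  fixes L :: "'h \<Rightarrow> 'h" and DL :: "'h set" and HN :: "nat \<Rightarrow> 'h set"
    and Proj :: "nat \<Rightarrow> 'h \<Rightarrow> 'h" and SN :: "nat \<Rightarrow> real \<Rightarrow> 'h \<Rightarrow>\<^sub>L 'h"
  assumes generator: "infinitesimal_generator S DL L"
    and subspaces: "\<And>N. N \<ge> 1 \<Longrightarrow> finite_dim_subspace (HN N) \<and> HN N \<subseteq> DL"
    and projectors: "\<And>N. N \<ge> 1 \<Longrightarrow> orthogonal_projector (HN N) (Proj N)"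
    and projectors_lim: "\<And>x. (\<lambda>N. norm (Proj N x - x)) \<longlonglongrightarrow> 0"
    and SN_c0: "\<And>N. N \<ge> 1 \<Longrightarrow> c0_semigroup (SN N)"
    and SN_flow: "\<And>N t x. N \<ge> 1 \<Longrightarrow> t \<ge> 0 \<Longrightarrow> x \<in> HN N \<Longrightarrow>
          SN N t x = exp_flow (galerkin_operator (Proj N) L) t x"
    and SN_growth: "\<And>N t. N \<ge> 1 \<Longrightarrow> t \<ge> 0 \<Longrightarrow> norm (SN N t) \<le> M * exp (\<omega> * t)"
    and consistent: "\<And>\<phi>. \<phi> \<in> DL \<Longrightarrow> (\<lambda>N. norm (galerkin_operator (Proj N) L \<phi> - L \<phi>)) \<longlonglongrightarrow> 0"
begin

section \<open>Linearity and boundedness of the Galerkin operators\<close>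

abbreviation L\<^sub>N :: "nat \<Rightarrow> 'h \<Rightarrow> 'h" where
  "L\<^sub>N N \<equiv> galerkin_operator (Proj N) L"

lemma subspace_HN: "N \<ge> 1 \<Longrightarrow> subspace (HN N)"
  using subspaces[of N] by (auto simp: finite_dim_subspace_def)

lemma Proj_in: "N \<ge> 1 \<Longrightarrow> Proj N x \<in> HN N"
  using projectors[of N] by (simp add: orthogonal_projector_def)

lemma Proj_ident: "N \<ge> 1 \<Longrightarrow> w \<in> HN N \<Longrightarrow> Proj N w = w"
  by (rule orthogonal_projector_eqI[OF projectors subspace_HN]) simp_all

lemma norm_Proj_le: "N \<ge> 1 \<Longrightarrow> norm (Proj N x) \<le> norm x"
  using orthogonal_projector_norm_le[OF projectors] .

lemma bounded_linear_Proj: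
  assumes "N \<ge> 1"
  shows "bounded_linear (Proj N)"
proof -
  obtain C where C: "\<And>x. Proj N x = (\<Sum>c\<in>C. (x \<bullet> c / (c \<bullet> c)) *\<^sub>R c)"
    using orthogonal_projector_expansion[OF projectors] subspaces assms by meson
  have "bounded_linear (\<lambda>x. \<Sum>c\<in>C. (x \<bullet> c / (c \<bullet> c)) *\<^sub>R c)"
    by (intro bounded_linear_sum bounded_linear_scaleR_const
        bounded_linear_compose[OF bounded_linear_divide] bounded_linear_inner_left)
  then show ?thesis
    by (simp flip: C)
qed

text \<open>Linearity of \<open>L\<close> on its domain comes from uniqueness of limits: both sides
  are limits of the same difference quotient.\<close>

lemma generator_combination:
  assumes C: "C \<subseteq> DL" and sum: "(\<Sum>c\<in>C. a c *\<^sub>R c) \<in> DL"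
  shows "L (\<Sum>c\<in>C. a c *\<^sub>R c) = (\<Sum>c\<in>C. a c *\<^sub>R L c)"
proof (rule tendsto_unique)
  let ?w = "\<Sum>c\<in>C. a c *\<^sub>R c"
  show "((\<lambda>h. (S h ?w - ?w) /\<^sub>R h) \<longlongrightarrow> L ?w) (at_right 0)"
    using generator sum by (auto simp: infinitesimal_generator_def)
  have "((\<lambda>h. \<Sum>c\<in>C. a c *\<^sub>R ((S h c - c) /\<^sub>R h)) \<longlongrightarrow> (\<Sum>c\<in>C. a c *\<^sub>R L c)) (at_right 0)"
    using generator C
    by (intro tendsto_sum tendsto_scaleR tendsto_const) (auto simp: infinitesimal_generator_def)
  moreover have "(\<Sum>c\<in>C. a c *\<^sub>R ((S h c - c) /\<^sub>R h)) = (S h ?w - ?w) /\<^sub>R h" for h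
    by (simp add: blinfun.sum_right blinfun.scaleR_right scaleR_sum_right scaleR_diff_right
        sum_subtractf mult.commute)
  ultimately show "((\<lambda>h. (S h ?w - ?w) /\<^sub>R h) \<longlongrightarrow> (\<Sum>c\<in>C. a c *\<^sub>R L c)) (at_right 0)"
    by simp
qed simp

text \<open>After projection the unbounded \<open>L\<close> meets only the finitely many vectors of
  an orthogonal spanning set; the rest is bounded coefficients.\<close>

lemma bounded_linear_LN:
  assumes N: "N \<ge> 1"
  shows "bounded_linear (L\<^sub>N N)"
proof -
  obtain C where C: "C \<subseteq> HN N" "\<And>x. Proj N x = (\<Sum>c\<in>C. (x \<bullet> c / (c \<bullet> c)) *\<^sub>R c)"
    using orthogonal_projector_expansion[OF projectors] subspaces N by meson
  have "L (Proj N x) = (\<Sum>c\<in>C. (x \<bullet> c / (c \<bullet> c)) *\<^sub>R L c)" for x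
    unfolding C(2) using C(1) subspaces[OF N] Proj_in[OF N, of x]
    by (intro generator_combination) (auto simp flip: C(2))
  moreover have "bounded_linear (\<lambda>x. Proj N (\<Sum>c\<in>C. (x \<bullet> c / (c \<bullet> c)) *\<^sub>R L c))"
    by (intro bounded_linear_compose[OF bounded_linear_Proj[OF N]] bounded_linear_sum
        bounded_linear_scaleR_const bounded_linear_compose[OF bounded_linear_divide]
        bounded_linear_inner_left)
  ultimately show ?thesis
    by (simp add: galerkin_operator_def[abs_def])
qed

lemma LN_Proj: "N \<ge> 1 \<Longrightarrow> L\<^sub>N N (Proj N x) = L\<^sub>N N x" "N \<ge> 1 \<Longrightarrow> Proj N (L\<^sub>N N x) = L\<^sub>N N x"
  by (simp_all add: galerkin_operator_def Proj_ident Proj_in)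

text \<open>The derivative of the orbit of the mean at time 0 is the generator quotient. As a result
  \<open>L\<close> after \<open>orbit_mean h\<close> is a bounded operator.\<close>

lemma generator_orbit_mean:
  assumes h: "h > 0"
  shows "orbit_mean h x \<in> DL" and "L (orbit_mean h x) = (S h x - x) /\<^sub>R h"
proof -
  have "((\<lambda>k. (S k (orbit_mean h x) - orbit_mean h x) /\<^sub>R k) \<longlongrightarrow> (S h x - x) /\<^sub>R h) (at_right 0)"
    using right_difference_quotient_tendsto[OF S_orbit_mean_has_vector_derivative[OF h, of 0 1 x]]
    by simp
  moreover from this show "orbit_mean h x \<in> DL"
    using generator by (auto simp: infinitesimal_generator_def)
  ultimately show "L (orbit_mean h x) = (S h x - x) /\<^sub>R h"
    using generator
    by (intro tendsto_unique[OF trivial_limit_at_right_real])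
      (auto simp: infinitesimal_generator_def)
qed

section \<open>Convergence of the Galerkin semigroups\<close>

lemma norm_SN_le:
  assumes "N \<ge> 1" "0 \<le> t" "t \<le> T"
  shows "norm (SN N t x) \<le> M * exp (\<omega> * T) * norm x"
proof -
  interpret SN: c0_semigroup_growth "SN N" M \<omega>
    using assms SN_c0 SN_growth M \<omega> by unfold_locales auto
  show ?thesis using assms by (intro SN.norm_S_le)
qed

text \<open>Joins two descriptions of the flow on \<open>HN N\<close>: the exponential can be
  differentiated, and \<open>SN N\<close> has a growth bound uniform in \<open>N\<close>.\<close>

lemma SN_eq_exp_blinfun:
  assumes "N \<ge> 1" "t \<ge> 0" "w \<in> HN N"
  shows "SN N t w = exp_blinfun (Blinfun (L\<^sub>N N)) t w"
  using assms by (simp add: exp_blinfun_apply SN_flow bounded_linear_Blinfun_apply bounded_linear_LN)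

text \<open>Mean value inequality for \<open>s \<mapsto> exp ((t - s) L\<^sub>N) \<Pi>\<^sub>N S(s) \<phi>\<close>, whose derivative is
  \<open>exp ((t - s) L\<^sub>N) \<Pi>\<^sub>N (L - L\<^sub>N) S(s) \<phi>\<close>.\<close>

lemma flow_error_le:
  assumes N: "N \<ge> 1" and h: "h > 0" and t: "0 \<le> t" "t \<le> T"
    and r: "\<And>s. s \<in> {0..T} \<Longrightarrow> norm (L (S s (orbit_mean h x)) - L\<^sub>N N (S s (orbit_mean h x))) \<le> r"
  shows "norm (Proj N (S t (orbit_mean h x)) - SN N t (Proj N (orbit_mean h x)))
           \<le> M * exp (\<omega> * T) * r * T"
proof -
  define B where "B = Blinfun (L\<^sub>N N)"
  define y where "y s = S s (orbit_mean h x)" for s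
  define g where "g s = exp_blinfun B (t - s) (Proj N (y s))" for s
  define g' where "g' s = exp_blinfun B (t - s) (Proj N (L (y s) - L\<^sub>N N (y s)))" for s
  have B: "blinfun_apply B = L\<^sub>N N"
    by (simp add: B_def bounded_linear_Blinfun_apply bounded_linear_LN[OF N])
  have Ly: "L (y s) = (S h (S s x) - S s x) /\<^sub>R h" if "s \<ge> 0" for s
    using that h by (simp add: y_def S_orbit_mean(1) generator_orbit_mean(2))
  have dg: "(g has_vector_derivative g' s) (at s within {0..t})" if s: "s \<in> {0..t}" for s
  proof -
    have "((\<lambda>s. t - s) has_vector_derivative - 1) (at s within {0..t})"
      by (auto intro!: derivative_eq_intros)
    then have "((exp_blinfun B \<circ> (\<lambda>s. t - s)) has_vector_derivative
        - 1 *\<^sub>R (exp_blinfun B (t - s) o\<^sub>L B)) (at s within {0..t})"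
      by (rule vector_diff_chain_within)
        (rule has_vector_derivative_at_within[OF exp_blinfun_has_vector_derivative])
    moreover have "((\<lambda>s. Proj N (y s)) has_vector_derivative Proj N (L (y s))) (at s within {0..t})"
      unfolding y_def using s
      by (intro bounded_linear.has_vector_derivative[OF bounded_linear_Proj[OF N]])
        (simp add: Ly[unfolded y_def] S_orbit_mean_has_vector_derivative h)
    ultimately have "(g has_vector_derivative exp_blinfun B (t - s) (Proj N (L (y s))) +
        (- 1 *\<^sub>R (exp_blinfun B (t - s) o\<^sub>L B)) (Proj N (y s))) (at s within {0..t})"
      unfolding g_def o_def
      by (rule bounded_bilinear.has_vector_derivative[OF bounded_bilinear_blinfun_apply])
    \<comment> \<open>The two product-rule terms merge because \<open>L\<^sub>N N\<close> is
      unchanged by \<open>Proj N\<close> on either side.\<close>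
    moreover have "exp_blinfun B (t - s) (Proj N (L (y s))) +
        (- 1 *\<^sub>R (exp_blinfun B (t - s) o\<^sub>L B)) (Proj N (y s)) = g' s"
      using N by (simp add: g'_def B LN_Proj blinfun.minus_left blinfun.diff_right
          bounded_linear.linear[OF bounded_linear_Proj] linear_diff)
    ultimately show ?thesis by simp
  qed
  have g'_le: "norm (g' s) \<le> M * exp (\<omega> * T) * r" if s: "s \<in> {0..t}" for s
  proof -
    \<comment> \<open>Back to \<open>SN N\<close>, whose bound is uniform in \<open>N\<close>;
      estimating through \<open>norm B\<close> would bring in a constant depending on
      \<open>N\<close>.\<close>
    have "g' s = SN N (t - s) (Proj N (L (y s) - L\<^sub>N N (y s)))"
      using s N by (simp add: g'_def B_def SN_eq_exp_blinfun Proj_in)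
    also have "norm \<dots> \<le> M * exp (\<omega> * T) * norm (Proj N (L (y s) - L\<^sub>N N (y s)))"
      using s t N by (intro norm_SN_le) auto
    also have "\<dots> \<le> M * exp (\<omega> * T) * r"
      using s t N M r[of s] norm_Proj_le[OF N, of "L (y s) - L\<^sub>N N (y s)"]
      by (intro mult_left_mono) (auto simp: y_def)
    finally show ?thesis .
  qed
  have "norm (g t - g 0) \<le> M * exp (\<omega> * T) * r * norm (t - 0)"
  proof (rule differentiable_bound[where S = "{0..t}" and f' = "\<lambda>s k. k *\<^sub>R g' s"])
    show "onorm (\<lambda>k. k *\<^sub>R g' s) \<le> M * exp (\<omega> * T) * r" if "s \<in> {0..t}" for s
    proof (rule onorm_le)
      show "norm (k *\<^sub>R g' s) \<le> M * exp (\<omega> * T) * r * norm k" for k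
        using mult_right_mono[OF g'_le[OF that] norm_ge_zero[of k]] by (simp add: mult.commute)
    qed
  qed (use dg t in \<open>auto simp: has_vector_derivative_def\<close>)
  moreover have "g t = Proj N (y t)"
    using SN_eq_exp_blinfun[OF N, of 0 "Proj N (y t)"] SN_c0[OF N] N
    by (simp add: g_def B_def Proj_in c0_semigroup_def)
  moreover have "g 0 = SN N t (Proj N (orbit_mean h x))"
    using SN_eq_exp_blinfun[OF N t(1)] N by (simp add: g_def B_def y_def Proj_in)
  \<comment> \<open>Enlarging \<open>t\<close> to \<open>T\<close> needs a nonnegative factor; it
    dominates a norm by \<open>g'_le\<close>.\<close>
  moreover have "M * exp (\<omega> * T) * r * norm (t - 0) \<le> M * exp (\<omega> * T) * r * T"
    using t order_trans[OF norm_ge_zero g'_le[of 0]] by (intro mult_left_mono) auto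
  ultimately show ?thesis
    by (simp add: y_def)
qed

text \<open>Since \<open>S(s)\<close> commutes with \<^term>\<open>orbit_mean h\<close>, the bounded operators
  \<open>L\<^sub>N \<circ> orbit_mean h\<close> are applied to the compact orbit of \<open>x\<close>. This replaces the uniform
  boundedness principle on the domain of \<open>L\<close> with the graph norm.\<close>

lemma consistent_uniformly_on_orbit:
  assumes h: "h > 0" and e: "e > 0"
  shows "\<forall>\<^sub>F N in sequentially. \<forall>s\<in>{0..T}.
    norm (L (S s (orbit_mean h x)) - L\<^sub>N N (S s (orbit_mean h x))) \<le> e"
proof -
  define J where "J = Blinfun (orbit_mean h)"
  define D where "D = (S h - id_blinfun) /\<^sub>R h"
  \<comment> \<open>The shift to \<open>Suc n\<close> makes every member bounded, since
    \<open>L\<^sub>N N\<close> is controlled only from \<open>N = 1\<close> on.\<close>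
  define A where "A n = Blinfun (L\<^sub>N (Suc n)) o\<^sub>L J" for n
  have J: "blinfun_apply J = orbit_mean h"
    by (simp add: J_def bounded_linear_Blinfun_apply bounded_linear_orbit_mean h)
  have A: "A n z = L\<^sub>N (Suc n) (orbit_mean h z)" for n z
    by (simp add: A_def J bounded_linear_Blinfun_apply bounded_linear_LN)
  have D: "L (orbit_mean h z) = D z" for z
    using h by (simp add: D_def generator_orbit_mean blinfun.scaleR_left blinfun.diff_left)
  have lim: "(\<lambda>n. norm (A n z - D z)) \<longlonglongrightarrow> 0" for z
    using consistent[OF generator_orbit_mean(1)[OF h], THEN LIMSEQ_Suc] by (simp add: A flip: D)
  have "\<exists>c. \<forall>n. norm (A n z) \<le> c" for z
  proof -
    have "(\<lambda>n. A n z) \<longlonglongrightarrow> D z"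
      using lim by (rule Lim_null[THEN iffD2, OF tendsto_norm_zero_cancel])
    then show ?thesis
      by (meson Bseq_def convergentI convergent_imp_Bseq)
  qed
  then obtain K where K: "\<And>n. norm (A n) \<le> K"
    using uniform_boundedness_principle by metis
  have lip: "norm ((A n - D) z - (A n - D) w) \<le> (K + norm D) * norm (z - w)" for n z w
  proof -
    have "norm ((A n - D) (z - w)) \<le> norm (A n - D) * norm (z - w)"
      by (rule norm_blinfun)
    also have "\<dots> \<le> (K + norm D) * norm (z - w)"
      using K[of n] norm_triangle_ineq4[of "A n" D] by (intro mult_right_mono) auto
    finally show ?thesis by (simp add: blinfun.diff_right)
  qed
  \<comment> \<open>The index set is a single point: time enters through the compact orbit
    instead.\<close>
  have "\<forall>\<^sub>F n in sequentially. \<forall>i\<in>{()}. \<forall>z\<in>(\<lambda>s. S s x) ` {0..T}. norm ((A n - D) z) \<le> e"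
  proof (rule uniformly_small_on_compact[where K = "K + norm D"])
    show "compact ((\<lambda>s. S s x) ` {0..T})"
      by (intro compact_continuous_image continuous_on_S) auto
    show "\<forall>\<^sub>F n in sequentially. \<forall>i\<in>{()}. norm ((A n - D) z) \<le> d" if "d > 0" for z d
      using eventually_mono[OF order_tendstoD(2)[OF lim that] less_imp_le] by (simp add: blinfun.diff_left)
  qed (use lip e in auto)
  then have "\<forall>\<^sub>F n in sequentially. \<forall>s\<in>{0..T}.
    norm (L (S s (orbit_mean h x)) - L\<^sub>N (Suc n) (S s (orbit_mean h x))) \<le> e"
    by (simp add: blinfun.diff_left A D S_orbit_mean(1) h norm_minus_commute)
  then show ?thesis
    by (subst (asm) eventually_sequentially_Suc)
qed

lemma Proj_uniformly_on_compact:
  assumes X: "compact X" and e: "e > 0"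
  shows "\<forall>\<^sub>F N in sequentially. \<forall>z\<in>X. norm (Proj N z - z) \<le> e"
proof -
  have "\<forall>\<^sub>F N in sequentially. \<forall>i\<in>{()}. \<forall>z\<in>X. norm (Proj N z - z) \<le> e"
  \<comment> \<open>The constant 2 is 1 for the contraction \<open>Proj N\<close> plus 1 for the
    identity.\<close>
  proof (rule uniformly_small_on_compact[OF X, where K = 2])
    show "\<forall>\<^sub>F n in sequentially. \<forall>i\<in>{()}. norm (Proj n z - z) \<le> d" if "d > 0" for z d
      using eventually_mono[OF order_tendstoD(2)[OF projectors_lim that] less_imp_le] by simp
    show "\<forall>\<^sub>F n in sequentially. \<forall>i\<in>{()}. \<forall>z w. norm ((Proj n z - z) - (Proj n w - w)) \<le> 2 * norm (z - w)"
      using eventually_ge_at_top[of 1]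
    proof eventually_elim
      case (elim n)
      have "norm ((Proj n z - z) - (Proj n w - w)) \<le> 2 * norm (z - w)" for z w
      proof -
        have "(Proj n z - z) - (Proj n w - w) = Proj n (z - w) - (z - w)"
          using elim by (simp add: bounded_linear.linear[OF bounded_linear_Proj] linear_diff)
        moreover have "norm (Proj n (z - w) - (z - w)) \<le> 2 * norm (z - w)"
          using norm_triangle_ineq4[of "Proj n (z - w)" "z - w"] norm_Proj_le[OF elim, of "z - w"]
          by linarith
        ultimately show ?thesis by (simp only:)
      qed
      then show ?case by simp
    qed
  qed (fact e)
  then show ?thesis by simp
qed

lemma norm_SN_Proj_le:
  assumes "N \<ge> 1" "0 \<le> t" "t \<le> T"
  shows "norm (SN N t (Proj N x)) \<le> M * exp (\<omega> * T) * norm x"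
proof -
  have "norm (SN N t (Proj N x)) \<le> M * exp (\<omega> * T) * norm (Proj N x)"
    using assms by (rule norm_SN_le)
  also have "\<dots> \<le> M * exp (\<omega> * T) * norm x"
    using M assms by (intro mult_left_mono norm_Proj_le) auto
  finally show ?thesis .
qed

lemma SN_Proj_diff: "N \<ge> 1 \<Longrightarrow> SN N t (Proj N (z - w)) = SN N t (Proj N z) - SN N t (Proj N w)"
  by (simp add: bounded_linear.linear[OF bounded_linear_Proj] linear_diff blinfun.diff_right)

text \<open>Four errors of size \<open>e / 4\<close> along the chain
  \<open>SN N t (Proj N x)\<close>, \<open>SN N t (Proj N \<phi>)\<close>,
  \<open>Proj N (S t \<phi>)\<close>, \<open>S t \<phi>\<close>, \<open>S t x\<close>, where
  \<open>\<phi>\<close> is an orbit mean near \<open>x\<close>.\<close>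

lemma trotter_kato:
  assumes e: "e > 0" and T: "T > 0"
  shows "\<forall>\<^sub>F N in sequentially. \<forall>t\<in>{0..T}. norm (SN N t (Proj N x) - S t x) \<le> e"
proof -
  define K where "K = M * exp (\<omega> * T)"
  have K: "K > 0" using M by (auto simp: K_def)
  have "\<forall>\<^sub>F h in at_right 0. dist (orbit_mean h x) x < e / (4 * K)"
    using orbit_mean_tendsto e K by (intro tendstoD) auto
  then obtain h where h: "h > 0" "norm (orbit_mean h x - x) < e / (4 * K)"
    unfolding dist_norm eventually_at_right_field using dense by blast
  define \<phi> where "\<phi> = orbit_mean h x"
  have \<phi>: "K * norm (\<phi> - x) \<le> e / 4"
    using h K by (simp add: \<phi>_def field_simps)
  \<comment> \<open>The consistency tolerance for which the bound \<open>K * r * T\<close> of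
    \<open>flow_error_le\<close> equals \<open>e / 4\<close>.\<close>
  define r where "r = e / (4 * K * T)"
  have r: "r > 0" "K * r * T = e / 4"
    using e K T by (auto simp: r_def)
  have "\<forall>\<^sub>F N in sequentially. \<forall>z\<in>(\<lambda>t. S t \<phi>) ` {0..T}. norm (Proj N z - z) \<le> e / 4"
    using e by (intro Proj_uniformly_on_compact compact_continuous_image continuous_on_S) auto
  then show ?thesis
    using eventually_ge_at_top[of 1] consistent_uniformly_on_orbit[OF h(1) r(1), of T x]
  proof eventually_elim
    case (elim N)
    show ?case
    proof
      fix t assume t: "t \<in> {0..T}"
      have "norm (Proj N (S t \<phi>) - SN N t (Proj N \<phi>)) \<le> e / 4"
        using flow_error_le[OF _ h(1), of N t T x r] elim t r by (simp add: \<phi>_def K_def)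
      moreover have "norm (SN N t (Proj N \<phi>) - SN N t (Proj N x)) \<le> e / 4"
        using norm_SN_Proj_le[of N t T "\<phi> - x"] elim t \<phi> by (simp add: SN_Proj_diff K_def)
      moreover have "norm (S t \<phi> - S t x) \<le> e / 4"
        using norm_S_le[of t T "\<phi> - x"] t \<phi> by (simp add: blinfun.diff_right K_def)
      moreover have "norm (Proj N (S t \<phi>) - S t \<phi>) \<le> e / 4"
        using elim t by blast
      ultimately show "norm (SN N t (Proj N x) - S t x) \<le> e"
        using dist_triangle[of "SN N t (Proj N x)" "S t x" "SN N t (Proj N \<phi>)"]
          dist_triangle[of "SN N t (Proj N \<phi>)" "S t x" "Proj N (S t \<phi>)"]
          dist_triangle[of "Proj N (S t \<phi>)" "S t x" "S t \<phi>"]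
        by (simp add: dist_norm norm_minus_commute)
    qed
  qed
qed

lemma trotter_kato_uniformly_on_compact:
  assumes X: "compact X" and e: "e > 0" and T: "T > 0"
  shows "\<forall>\<^sub>F N in sequentially. \<forall>t\<in>{0..T}. \<forall>z\<in>X. norm (SN N t (Proj N z) - S t z) \<le> e"
proof (rule uniformly_small_on_compact[OF X trotter_kato _ e, where K = "2 * (M * exp (\<omega> * T))"])
  show "\<forall>\<^sub>F N in sequentially. \<forall>t\<in>{0..T}. \<forall>z w.
    norm ((SN N t (Proj N z) - S t z) - (SN N t (Proj N w) - S t w)) \<le> 2 * (M * exp (\<omega> * T)) * norm (z - w)"
    using eventually_ge_at_top[of 1]
  proof eventually_elim
    case (elim N)
    show ?case
    proof (intro ballI allI)
      fix t z w assume t: "t \<in> {0..T}"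
      have "(SN N t (Proj N z) - S t z) - (SN N t (Proj N w) - S t w) =
          SN N t (Proj N (z - w)) - S t (z - w)"
        using elim by (simp add: SN_Proj_diff blinfun.diff_right)
      moreover have "norm (SN N t (Proj N (z - w)) - S t (z - w)) \<le> 2 * (M * exp (\<omega> * T)) * norm (z - w)"
        using norm_SN_Proj_le[of N t T "z - w"] norm_S_le[of t T "z - w"] elim t
          norm_triangle_ineq4[of "SN N t (Proj N (z - w))" "S t (z - w)"]
        by simp
      ultimately show "norm ((SN N t (Proj N z) - S t z) - (SN N t (Proj N w) - S t w))
          \<le> 2 * (M * exp (\<omega> * T)) * norm (z - w)"
        by (simp only:)
    qed
  qed
qed (use T in auto)

end

subsection \<open>Uniform convergence of the mild solutions\<close>

lemma orthogonal_projector_image_compact: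
  assumes P: "orthogonal_projector S P" and S: "finite_dim_subspace S"
  shows "\<exists>Z. compact Z \<and> (\<forall>x. norm x \<le> r \<longrightarrow> P x \<in> Z)"
proof -
  obtain C where C: "finite C" "\<And>x. P x = (\<Sum>c\<in>C. (x \<bullet> c / (c \<bullet> c)) *\<^sub>R c)"
    using orthogonal_projector_expansion[OF P S] by blast
  \<comment> \<open>The sum is a common bound for all coefficients: by Cauchy-Schwarz each is at
    most its own summand \<open>r / norm c\<close>.\<close>
  define R where "R = (\<Sum>c\<in>C. r / norm c)"
  have "\<bar>x \<bullet> c / (c \<bullet> c)\<bar> \<le> R" if "norm x \<le> r" "c \<in> C" for x c
  proof -
    have r: "r \<ge> 0" using that norm_ge_zero[of x] by linarith
    have "\<bar>x \<bullet> c / (c \<bullet> c)\<bar> \<le> norm x * norm c / (norm c * norm c)"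
      using divide_right_mono[OF Cauchy_Schwarz_ineq2[of x c] zero_le_square[of "norm c"]]
      by (simp only: abs_divide dot_square_norm power2_eq_square abs_mult abs_norm_cancel)
    also have "\<dots> = norm x / norm c" by simp
    also have "\<dots> \<le> r / norm c"
      using that by (intro divide_right_mono) auto
    also have "\<dots> \<le> R"
      unfolding R_def using C(1) that r by (intro member_le_sum) auto
    finally show ?thesis .
  qed
  then have "P x \<in> {\<Sum>c\<in>C. a c *\<^sub>R c | a. \<forall>c\<in>C. \<bar>a c\<bar> \<le> R}" if "norm x \<le> r" for x
    using that unfolding C(2) by (intro CollectI exI[of _ "\<lambda>c. x \<bullet> c / (c \<bullet> c)"]) simp
  then show ?thesis
    using compact_bounded_combinations[OF C(1)] by blast
qed

text \<open>Suprema in \<open>ennreal\<close> always exist, so no boundedness has to be known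
  beforehand. The inner bound is non-strict because a supremum does not preserve strict
  inequalities.\<close>

lemma tendsto_0_SUP_SUP_iff:
  fixes f :: "'n \<Rightarrow> 'a \<Rightarrow> 'b \<Rightarrow> real"
  shows "((\<lambda>n. SUP u\<in>A. SUP t\<in>B. ennreal (f n u t)) \<longlongrightarrow> 0) G \<longleftrightarrow>
    (\<forall>e>0. \<forall>\<^sub>F n in G. \<forall>u\<in>A. \<forall>t\<in>B. f n u t \<le> e)" (is "?lhs \<longleftrightarrow> ?rhs")
proof
  assume lim: ?lhs
  show ?rhs
  proof (intro allI impI)
    fix e :: real assume e: "e > 0"
    have "\<forall>\<^sub>F n in G. (SUP u\<in>A. SUP t\<in>B. ennreal (f n u t)) < ennreal e"
      using order_tendstoD(2)[OF lim] e by simp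
    then show "\<forall>\<^sub>F n in G. \<forall>u\<in>A. \<forall>t\<in>B. f n u t \<le> e"
    proof eventually_elim
      case (elim n)
      then have "(SUP u\<in>A. SUP t\<in>B. ennreal (f n u t)) \<le> ennreal e"
        by (rule less_imp_le)
      then show ?case
        using e by (auto simp: SUP_le_iff)
    qed
  qed
next
  assume small: ?rhs
  show ?lhs
  proof (rule order_tendstoI)
    fix a :: ennreal assume "0 < a"
    then obtain e :: real where e: "e > 0" "ennreal e < a"
    proof (cases a rule: ennreal_cases)
      case (real r)
      then show ?thesis
        using \<open>0 < a\<close> by (intro that[of "r / 2"]) (auto simp: ennreal_less_iff)
    next
      case top
      then show ?thesis by (intro that[of 1]) auto
    qed
    have "\<forall>\<^sub>F n in G. \<forall>u\<in>A. \<forall>t\<in>B. f n u t \<le> e"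
      using small e(1) by blast
    then show "\<forall>\<^sub>F n in G. (SUP u\<in>A. SUP t\<in>B. ennreal (f n u t)) < a"
    proof eventually_elim
      case (elim n)
      then have "(SUP u\<in>A. SUP t\<in>B. ennreal (f n u t)) \<le> ennreal e"
        by (intro SUP_least ennreal_leI) auto
      then show ?case using e(2) by simp
    qed
  qed simp
qed

section \<open>Error estimate for mild solutions\<close>

text \<open>Subtracting the two integral equations leaves an initial error \<open>\<delta>\<close>
  and an error of at most \<open>\<delta> * T\<close> from each integral, hence the Gronwall
  constant \<open>\<delta> * (1 + 2 * T)\<close>. The null set in the control condition is the same
  for all \<open>t\<close>.\<close>

lemma mild_solution_difference_le:
  fixes z y :: "real \<Rightarrow> 'h::{real_inner, banach, second_countable_topology}"
  assumes z: "mild_solution E F' g' x' T z" and y: "mild_solution S F g x T y"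
    and T: "0 \<le> T" and b: "0 < b" and \<delta>: "0 \<le> \<delta>"
    and init: "\<And>t. t \<in> {0..T} \<Longrightarrow> norm (E t x' - S t x) \<le> \<delta>"
    and nonlin: "\<And>t s. t \<in> {0..T} \<Longrightarrow> s \<in> {0..t} \<Longrightarrow>
      norm (E (t - s) (F' (z s)) - S (t - s) (F (y s))) \<le> b * norm (z s - y s) + \<delta>"
    and ctrl: "AE s in lebesgue_on {0..T}. \<forall>t\<in>{s..T}. norm (E (t - s) (g' s) - S (t - s) (g s)) \<le> \<delta>"
    and t: "t \<in> {0..T}"
  shows "norm (z t - y t) \<le> 2 * (\<delta> * (1 + 2 * T)) * exp (2 * b * T)"
proof (rule gronwall_le[OF _ T b _ t])
  have cz: "continuous_on {0..T} z" and cy: "continuous_on {0..T} y"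
    using z y by (auto simp: mild_solution_def)
  show cont: "continuous_on {0..T} (\<lambda>t. norm (z t - y t))"
    by (intro continuous_intros cz cy)
  show "0 \<le> \<delta> * (1 + 2 * T)" using T \<delta> by simp
  fix t assume t: "t \<in> {0..T}"
  let ?m = "lebesgue_on {0..t}"
  define d1 where "d1 s = E (t - s) (F' (z s)) - S (t - s) (F (y s))" for s
  define d2 where "d2 s = E (t - s) (g' s) - S (t - s) (g s)" for s
  have int: "integrable ?m (\<lambda>s. E (t - s) (F' (z s)))" "integrable ?m (\<lambda>s. S (t - s) (F (y s)))"
    "integrable ?m (\<lambda>s. E (t - s) (g' s))" "integrable ?m (\<lambda>s. S (t - s) (g s))"
    using z y t by (auto simp: mild_solution_def)
  then have int_d: "integrable ?m d1" "integrable ?m d2"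
    by (auto simp: d1_def[abs_def] d2_def[abs_def])
  have "z t = E t x' + (LINT s|?m. E (t - s) (F' (z s))) + (LINT s|?m. E (t - s) (g' s))"
    using z t by (auto simp: mild_solution_def)
  moreover have "y t = S t x + (LINT s|?m. S (t - s) (F (y s))) + (LINT s|?m. S (t - s) (g s))"
    using y t by (auto simp: mild_solution_def)
  ultimately have "z t - y t = (E t x' - S t x) + (LINT s|?m. d1 s) + (LINT s|?m. d2 s)"
    using int by (simp add: d1_def d2_def)
  then have "norm (z t - y t) \<le> norm (E t x' - S t x) + norm (LINT s|?m. d1 s) + norm (LINT s|?m. d2 s)"
    by (simp add: norm_triangle_le norm_triangle_ineq)
  moreover have "norm (LINT s|?m. d1 s) \<le> b * integral {0..t} (\<lambda>s. norm (z s - y s)) + \<delta> * t"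
  proof -
    have c: "continuous_on {0..t} (\<lambda>s. norm (z s - y s))"
      using t by (intro continuous_on_subset[OF cont]) auto
    then have c': "continuous_on {0..t} (\<lambda>s. b * norm (z s - y s) + \<delta>)"
      by (intro continuous_on_add continuous_on_mult continuous_on_const)
    have "norm (LINT s|?m. d1 s) \<le> (LINT s|?m. b * norm (z s - y s) + \<delta>)"
      using nonlin[OF t]
      by (intro Bochner_Integration.integral_norm_bound_integral[OF int_d(1)]
          continuous_imp_integrable_real[OF c']) (auto simp: d1_def)
    also have "\<dots> = integral {0..t} (\<lambda>s. b * norm (z s - y s) + \<delta>)"
      by (intro lebesgue_integral_eq_integral continuous_imp_integrable_real[OF c']) auto
    also have "\<dots> = b * integral {0..t} (\<lambda>s. norm (z s - y s)) + \<delta> * t"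
      using t integrable_on_mult_right[OF integrable_continuous_real[OF c], of b]
      by (subst Henstock_Kurzweil_Integration.integral_add) auto
    finally show ?thesis .
  qed
  moreover have "norm (LINT s|?m. d2 s) \<le> \<delta> * t"
  proof -
    \<comment> \<open>Passing through the full measure restricts the null set from
      \<open>{0..T}\<close> to \<open>{0..t}\<close>.\<close>
    have "AE s in lebesgue. s \<in> {0..T} \<longrightarrow>
        (\<forall>t\<in>{s..T}. norm (E (t - s) (g' s) - S (t - s) (g s)) \<le> \<delta>)"
      using ctrl by (simp add: AE_restrict_space_iff)
    then have "AE s in lebesgue. s \<in> {0..t} \<longrightarrow> norm (d2 s) \<le> \<delta>"
      by (rule AE_mp) (use t in \<open>auto simp: d2_def\<close>)
    then have ae: "AE s in ?m. norm (d2 s) \<le> \<delta>"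
      by (simp add: AE_restrict_space_iff)
    have c: "integrable ?m (\<lambda>s. \<delta>)"
      by (intro continuous_imp_integrable_real continuous_intros)
    have "norm (LINT s|?m. d2 s) \<le> (LINT s|?m. norm (d2 s))"
      by (rule integral_norm_bound)
    also have "\<dots> \<le> (LINT s|?m. \<delta>)"
      using int_d(2) c ae by (intro integral_mono_AE) auto
    also have "\<dots> = \<delta> * t"
      using t lebesgue_integral_eq_integral[OF c] by simp
    finally show ?thesis .
  qed
  moreover have "norm (E t x' - S t x) \<le> \<delta>" using init t .
  moreover have "\<delta> * t \<le> \<delta> * T" using t \<delta> by (intro mult_left_mono) auto
  ultimately show "norm (z t - y t)
      \<le> \<delta> * (1 + 2 * T) + b * integral {0..t} (\<lambda>s. norm (z s - y s))"
    by (simp add: algebra_simps)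
qed

theorem theorem2p1:
  fixes F :: "'h::{real_inner, banach, second_countable_topology} \<Rightarrow> 'h"
    and CC :: "'v::{real_inner, banach, second_countable_topology} \<Rightarrow> 'h"
    and L :: "'h \<Rightarrow> 'h" and DL :: "'h set"
    and S :: "real \<Rightarrow> ('h \<Rightarrow>\<^sub>L 'h)"
    and M \<omega> q :: real
    and HN :: "nat \<Rightarrow> 'h set"
    and Proj LN :: "nat \<Rightarrow> 'h \<Rightarrow> 'h"
    and SN :: "nat \<Rightarrow> real \<Rightarrow> ('h \<Rightarrow>\<^sub>L 'h)"
    and U :: "'v set"
    and Uad :: "real \<Rightarrow> (real \<Rightarrow> 'v) set"
    and y :: "real \<Rightarrow> 'h \<Rightarrow> (real \<Rightarrow> 'v) \<Rightarrow> real \<Rightarrow> 'h"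
    and yN :: "nat \<Rightarrow> real \<Rightarrow> 'h \<Rightarrow> (real \<Rightarrow> 'v) \<Rightarrow> real \<Rightarrow> 'h"
  assumes CC_0: "CC 0 = 0"
    and semigroup: "c0_semigroup S"
    and generator: "infinitesimal_generator S DL L"
    and M: "M \<ge> 1" and \<omega>: "\<omega> \<ge> 0"
    and growth: "\<And>t. t \<ge> 0 \<Longrightarrow> norm (S t) \<le> M * exp (\<omega> * t)"
    and subspaces: "\<And>N. N \<ge> 1 \<Longrightarrow> finite_dim_subspace (HN N) \<and> HN N \<subseteq> DL"
    and projectors: "\<And>N. N \<ge> 1 \<Longrightarrow> orthogonal_projector (HN N) (Proj N)"
    and projectors_lim: "\<And>x. (\<lambda>N. norm (Proj N x - x)) \<longlonglongrightarrow> 0"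
    and q: "q \<ge> 1"
    and U: "compact U"
    and LN_def: "\<And>N. LN N = galerkin_operator (Proj N) L"
    and Uad_def: "\<And>T. Uad T = admissible_controls q U T"
    and a: "\<And>N. N \<ge> 1 \<Longrightarrow> c0_semigroup (SN N) \<and>
          (\<forall>t\<ge>0. \<forall>x\<in>HN N. blinfun_apply (SN N t) x = exp_flow (LN N) t x) \<and>
          (\<forall>t\<ge>0. norm (SN N t) \<le> M * exp (\<omega> * t))"
    and b: "\<And>\<phi>. \<phi> \<in> DL \<Longrightarrow> (\<lambda>N. norm (LN N \<phi> - L \<phi>)) \<longlonglongrightarrow> 0"
    and c: "lipschitz_on_balls F"
    and d_state: "\<And>T x u. T > 0 \<Longrightarrow> u \<in> Uad T \<Longrightarrow>
          unique_mild_solution (\<lambda>t. blinfun_apply (S t)) F (\<lambda>s. CC (u s)) x T (y T x u)"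
    and d_galerkin: "\<And>N T x u. N \<ge> 1 \<Longrightarrow> T > 0 \<Longrightarrow> u \<in> Uad T \<Longrightarrow>
          unique_mild_solution (exp_flow (LN N)) (\<lambda>z. Proj N (F z)) (\<lambda>s. Proj N (CC (u s)))
            (Proj N x) T (yN N T x u)"
    and d_bound: "\<And>T x. T > 0 \<Longrightarrow> \<exists>C. \<forall>u\<in>Uad T. \<forall>t\<in>{0..T}.
          norm (y T x u t) \<le> C \<and> (\<forall>N\<ge>1. norm (yN N T x u t) \<le> C)"
    and e: "\<And>T x. T > 0 \<Longrightarrow>
          (\<lambda>N. SUP u\<in>Uad T. SUP t\<in>{0..T}. ennreal (norm (y T x u t - Proj N (y T x u t)))) \<longlonglongrightarrow> 0"
    and f: "continuous_on UNIV CC"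
  shows "\<forall>T>0. \<forall>x. (\<lambda>N. SUP u\<in>Uad T. SUP t\<in>{0..T}.
            ennreal (norm (yN N T x u t - y T x u t))) \<longlonglongrightarrow> 0"
proof (intro allI impI)
  fix T :: real and x :: 'h
  assume T: "T > 0"
  interpret galerkin_approximation S M \<omega> L DL HN Proj SN
    using semigroup growth M \<omega> generator subspaces projectors projectors_lim a b
    unfolding LN_def by unfold_locales blast+
  obtain C where C: "\<And>u t. u \<in> Uad T \<Longrightarrow> t \<in> {0..T} \<Longrightarrow> norm (y T x u t) \<le> C"
    "\<And>N u t. N \<ge> 1 \<Longrightarrow> u \<in> Uad T \<Longrightarrow> t \<in> {0..T} \<Longrightarrow> norm (yN N T x u t) \<le> C"
    using d_bound[OF T, of x] by blast
  \<comment> \<open>Radius \<open>C + 1\<close>, because the balls are open while solutions may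
    attain norm \<open>C\<close>.\<close>
  obtain k where k: "k-lipschitz_on (ball 0 (C + 1)) F"
    using c unfolding lipschitz_on_balls_def by blast
  define Y where "Y = {y T x u t | u t. u \<in> Uad T \<and> t \<in> {0..T}}"
  have "compact (closure Y)"
  proof (rule compact_closure_if_near_compact)
    fix r :: real
    assume "r > 0"
    then have "\<forall>\<^sub>F N in sequentially. \<forall>u\<in>Uad T. \<forall>t\<in>{0..T}. norm (y T x u t - Proj N (y T x u t)) \<le> r"
      using e[OF T, of x] unfolding tendsto_0_SUP_SUP_iff by blast
    \<comment> \<open>An index that is also at least 1 is needed, so that \<open>Proj N\<close> has
      finite-dimensional range and maps a bounded set into a compact one.\<close>
    then have "\<forall>\<^sub>F N in sequentially. N \<ge> 1 \<and>
        (\<forall>u\<in>Uad T. \<forall>t\<in>{0..T}. norm (y T x u t - Proj N (y T x u t)) \<le> r)"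
      using eventually_ge_at_top by (rule eventually_conj[rotated])
    then obtain N where N: "N \<ge> 1"
      "\<And>u t. u \<in> Uad T \<Longrightarrow> t \<in> {0..T} \<Longrightarrow> norm (y T x u t - Proj N (y T x u t)) \<le> r"
      using eventually_happens'[OF sequentially_bot] by blast
    obtain Z where "compact Z" "\<And>w. norm w \<le> C \<Longrightarrow> Proj N w \<in> Z"
      using orthogonal_projector_image_compact[OF projectors] subspaces N(1) by meson
    then show "\<exists>Z. compact Z \<and> (\<forall>w\<in>Y. \<exists>z\<in>Z. norm (w - z) \<le> r)"
      using C(1) N(2) unfolding Y_def by blast
  qed
  \<comment> \<open>Closing \<open>Y\<close> does not leave the closed ball of radius
    \<open>C\<close>, so \<open>F\<close> remains continuous there.\<close>
  moreover have "closure Y \<subseteq> cball 0 C"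
    using C(1) by (intro closure_minimal) (auto simp: Y_def)
  then have "continuous_on (closure Y) F"
    by (intro continuous_on_subset[OF lipschitz_on_continuous_on[OF k]]) auto
  ultimately have FY: "compact (F ` closure Y)"
    by (intro compact_continuous_image)
  have "compact (CC ` U)"
    by (intro compact_continuous_image continuous_on_subset[OF f] U) auto
  with FY have X: "compact (insert x (F ` closure Y \<union> CC ` U))" (is "compact ?X")
    by (intro compact_insert compact_Un)
  define K where "K = M * exp (\<omega> * T)"
  \<comment> \<open>\<open>K * k\<close> is the Lipschitz constant after the semigroup; the added 1
    gives the positivity that Gronwall requires even when \<open>k = 0\<close>.\<close>
  define \<beta> where "\<beta> = K * k + 1"
  have K: "K > 0" using M by (auto simp: K_def)
  have k0: "k \<ge> 0" using k by (rule lipschitz_on_nonneg)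
  have \<beta>: "\<beta> > 0" using K k0 by (simp add: \<beta>_def add_nonneg_pos)
  show "(\<lambda>N. SUP u\<in>Uad T. SUP t\<in>{0..T}. ennreal (norm (yN N T x u t - y T x u t))) \<longlonglongrightarrow> 0"
    unfolding tendsto_0_SUP_SUP_iff
  proof (intro allI impI)
    fix r :: real assume r: "r > 0"
    \<comment> \<open>The Gronwall amplification factor, so that the tolerance
      \<open>\<delta> = r / d\<close> ends in exactly \<open>r\<close>.\<close>
    define d where "d = 2 * (1 + 2 * T) * exp (2 * \<beta> * T)"
    define \<delta> where "\<delta> = r / d"
    have "d > 0" using T by (simp add: d_def)
    then have "\<delta> > 0" "\<delta> * d = r"
      using r by (auto simp: \<delta>_def)
    then have \<delta>: "\<delta> > 0" and \<delta>_eq: "2 * (\<delta> * (1 + 2 * T)) * exp (2 * \<beta> * T) = r"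
      by (simp_all only: d_def mult_ac)
    show "\<forall>\<^sub>F N in sequentially. \<forall>u\<in>Uad T. \<forall>t\<in>{0..T}. norm (yN N T x u t - y T x u t) \<le> r"
      using trotter_kato_uniformly_on_compact[OF X \<delta> T] eventually_ge_at_top[of 1]
    proof eventually_elim
      case (elim N)
      then have N: "N \<ge> 1" and close:
        "\<And>t z. t \<in> {0..T} \<Longrightarrow> z \<in> ?X \<Longrightarrow> norm (SN N t (Proj N z) - S t z) \<le> \<delta>"
        by blast+
      \<comment> \<open>Every argument is projected first, so it lies in \<open>HN N\<close>, where
        the exponential flow and \<open>SN N\<close> agree.\<close>
      have flow: "exp_flow (LN N) t (Proj N z) = SN N t (Proj N z)" if "t \<ge> 0" for t z
        using a[OF N] Proj_in[OF N] that by simp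
      show ?case
      proof (intro ballI)
        fix u t
        assume u: "u \<in> Uad T" and t: "t \<in> {0..T}"
        have "norm (yN N T x u t - y T x u t) \<le> 2 * (\<delta> * (1 + 2 * T)) * exp (2 * \<beta> * T)"
        proof (rule mild_solution_difference_le[OF _ _ _ \<beta> _ _ _ _ t])
          show "mild_solution (exp_flow (LN N)) (\<lambda>z. Proj N (F z)) (\<lambda>s. Proj N (CC (u s)))
              (Proj N x) T (yN N T x u)"
            using d_galerkin[OF N T u] by (simp add: unique_mild_solution_def)
          show "mild_solution (\<lambda>t. blinfun_apply (S t)) F (\<lambda>s. CC (u s)) x T (y T x u)"
            using d_state[OF T u] by (simp add: unique_mild_solution_def)
          show "0 \<le> T" "0 \<le> \<delta>" using T \<delta> by auto
          show "norm (exp_flow (LN N) t (Proj N x) - S t x) \<le> \<delta>" if "t \<in> {0..T}" for t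
            using close[OF that] that by (simp add: flow)
          show "norm (exp_flow (LN N) (t - s) (Proj N (F (yN N T x u s))) - S (t - s) (F (y T x u s)))
              \<le> \<beta> * norm (yN N T x u s - y T x u s) + \<delta>"
            if t: "t \<in> {0..T}" and s: "s \<in> {0..t}" for t s
          proof -
            let ?z = "yN N T x u s" and ?y = "y T x u s"
            have sT: "s \<in> {0..T}" and tsT: "t - s \<in> {0..T}" using s t by auto
            have "?y \<in> Y" using u sT by (auto simp: Y_def)
            then have "F ?y \<in> ?X" using closure_subset by blast
            then have 1: "norm (SN N (t - s) (Proj N (F ?y)) - S (t - s) (F ?y)) \<le> \<delta>"
              using close tsT by blast
            have "norm (SN N (t - s) (Proj N (F ?z - F ?y))) \<le> K * norm (F ?z - F ?y)"
              using norm_SN_Proj_le[OF N] tsT by (simp add: K_def)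
            also have "\<dots> \<le> K * (k * norm (?z - ?y))"
              using lipschitz_onD[OF k, of ?z ?y] C(1)[OF u sT] C(2)[OF N u sT] K
              by (intro mult_left_mono) (auto simp: dist_norm)
            also have "\<dots> \<le> \<beta> * norm (?z - ?y)"
              by (simp add: \<beta>_def distrib_right)
            finally have 2: "norm (SN N (t - s) (Proj N (F ?z)) - SN N (t - s) (Proj N (F ?y)))
                \<le> \<beta> * norm (?z - ?y)"
              using N by (simp add: SN_Proj_diff)
            show ?thesis
              using norm_triangle_le[OF add_mono[OF 2 1]] s by (simp add: flow)
          qed
          have "AE s in lebesgue_on {0..T}. u s \<in> U"
            using u by (simp add: Uad_def admissible_controls_def)
          \<comment> \<open>Together with \<open>t \<in> {s..T}\<close> this places
            \<open>t - s\<close> in \<open>{0..T}\<close>, as \<open>close\<close> demands.\<close>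
          moreover have "AE s in lebesgue_on {0..T}. s \<in> {0..T}"
            by (rule AE_I2) simp
          ultimately show "AE s in lebesgue_on {0..T}. \<forall>t\<in>{s..T}.
              norm (exp_flow (LN N) (t - s) (Proj N (CC (u s))) - S (t - s) (CC (u s))) \<le> \<delta>"
            by eventually_elim (auto simp: flow intro!: close)
        qed
        then show "norm (yN N T x u t - y T x u t) \<le> r"
          by (simp only: \<delta>_eq)
      qed
    qed
  qed
qed

end
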